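(* There is a $3$-approximation algorithm for the Label-consistent $k$-center problem running in time $O(n^2\log n + nk\log n)$, where $n=|X|$.
   Context: Let $(X,d)$ be a finite metric space with $n=|X|$ points. A $k$-clustering of $X$ is a pair $\mathcal{C}=(C,\ell_C)$ where $C\subseteq X$ is a set of $k$ centers and $\ell_C:X\to C$ is a labeling function assigning each point to a center (not necessarily the closest one). Its $k$-center cost is $\mathrm{cost}_\infty(\mathcal{C})=\max_{x\in X} d(x,\ell_C(x))$. For two $k$-clusterings $\mathcal{C}_1=(C_1,\ell_1)$, $\mathcal{C}_2=(C_2,\ell_2)$ of $X$, $\Delta(\mathcal{C}_1,\mathcal{C}_2)=|\{x\in X:\ell_1(x)\neq\ell_2(x)\}|$. Label-consistent $k$-center: given $(X,d)$, positive integers $k,b$, and a historical $k$-clustering $\mathcal{H}=(H,\ell_H)$ of $X$ with $|H|=k$, find a $k$-clustering $\mathcal{C}=(C,\ell_C)$ of $X$ with $|C|=k$ and $\Delta(\mathcal{H},\mathcal{C})\le b$ (a feasible solution) minimizing $\mathrm{cost}_\infty(\mathcal{C})$; $r^*$ denotes the optimal cost. A $3$-approximation algorithm returns a feasible solution of cost at most $3r^*$. *)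

theory Defs
  imports "HOL-Analysis.Analysis"
begin

type_synonym 'a clustering = "'a set \<times> ('a \<Rightarrow> 'a)"

definition is_clustering :: "'a set \<Rightarrow> nat \<Rightarrow> 'a clustering \<Rightarrow> bool" where
  "is_clustering X k \<C> \<longleftrightarrow>
     fst \<C> \<subseteq> X \<and> card (fst \<C>) = k \<and> snd \<C> \<in> X \<rightarrow> fst \<C>"

definition cost_inf :: "'a set \<Rightarrow> ('a \<Rightarrow> 'a \<Rightarrow> real) \<Rightarrow> 'a clustering \<Rightarrow> real" where
  "cost_inf X d \<C> = Max ((\<lambda>x. d x (snd \<C> x)) ` X)"

definition label_diff :: "'a set \<Rightarrow> 'a clustering \<Rightarrow> 'a clustering \<Rightarrow> nat" where
  "label_diff X \<C>\<^sub>1 \<C>\<^sub>2 = card {x \<in> X. snd \<C>\<^sub>1 x \<noteq> snd \<C>\<^sub>2 x}"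

definition lc_instance ::
  "'a set \<Rightarrow> ('a \<Rightarrow> 'a \<Rightarrow> real) \<Rightarrow> nat \<Rightarrow> nat \<Rightarrow> 'a clustering \<Rightarrow> bool" where
  "lc_instance X d k b \<H> \<longleftrightarrow>
     finite X \<and> Metric_space X d \<and> 0 < k \<and> 0 < b \<and> is_clustering X k \<H>"

definition lc_feasible ::
  "'a set \<Rightarrow> nat \<Rightarrow> nat \<Rightarrow> 'a clustering \<Rightarrow> 'a clustering \<Rightarrow> bool" where
  "lc_feasible X k b \<H> \<C> \<longleftrightarrow> is_clustering X k \<C> \<and> label_diff X \<H> \<C> \<le> b"

definition lc_opt ::
  "'a set \<Rightarrow> ('a \<Rightarrow> 'a \<Rightarrow> real) \<Rightarrow> nat \<Rightarrow> nat \<Rightarrow> 'a clustering \<Rightarrow> real" where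
  "lc_opt X d k b \<H> = Min (cost_inf X d ` {\<C>. lc_feasible X k b \<H> \<C>})"

text \<open>
  The set under the minimum in \<^const>\<open>lc_opt\<close> is finite and nonempty, although there are
  infinitely many feasible pairs when labelings may take arbitrary values outside \<open>X\<close>.
\<close>

lemma lc_opt_attained:
  assumes "lc_instance X d k b \<H>"
  shows "\<exists>\<C>. lc_feasible X k b \<H> \<C> \<and> cost_inf X d \<C> = lc_opt X d k b \<H>"
    and "\<And>\<C>. lc_feasible X k b \<H> \<C> \<Longrightarrow> lc_opt X d k b \<H> \<le> cost_inf X d \<C>"
proof -
  let ?F = "{\<C>. lc_feasible X k b \<H> \<C>}"
  have X: "finite X" and H: "is_clustering X k \<H>" and k: "0 < k"
    using assms by (auto simp: lc_instance_def)
  have ne: "X \<noteq> {}"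
    using H k by (auto simp: is_clustering_def)
  have "\<H> \<in> ?F"
    using H by (simp add: lc_feasible_def label_diff_def)
  then have F: "cost_inf X d ` ?F \<noteq> {}" by blast
  have "cost_inf X d ` ?F \<subseteq> (\<lambda>(x, y). d x y) ` (X \<times> X)"
  proof
    fix r assume "r \<in> cost_inf X d ` ?F"
    then obtain \<C> where C: "is_clustering X k \<C>" and r: "r = cost_inf X d \<C>"
      by (auto simp: lc_feasible_def)
    have "r \<in> (\<lambda>x. d x (snd \<C> x)) ` X"
      unfolding r cost_inf_def using X ne by (intro Max_in) auto
    then show "r \<in> (\<lambda>(x, y). d x y) ` (X \<times> X)"
      using C by (force simp: is_clustering_def)
  qed
  then have fin: "finite (cost_inf X d ` ?F)"
    by (rule finite_subset) (use X in simp)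
  show "\<exists>\<C>. lc_feasible X k b \<H> \<C> \<and> cost_inf X d \<C> = lc_opt X d k b \<H>"
    using Min_in[OF fin F] unfolding lc_opt_def by (metis (mono_tags) imageE mem_Collect_eq)
  show "\<And>\<C>. lc_feasible X k b \<H> \<C> \<Longrightarrow> lc_opt X d k b \<H> \<le> cost_inf X d \<C>"
    unfolding lc_opt_def using fin by (intro Min_le) auto
qed

text \<open>
  Programs are while programs over scalar variables and unbounded zero-based arrays, holding
  either natural numbers or exact reals. Every operator, variable access, array access and
  assignment or test costs one unit. The operations are kept weak enough for unit cost to be
  reasonable: there is no multiplication, and reals can only be copied, added, subtracted and
  compared; there is no conversion between the two sorts.
\<close>

type_synonym vname = string

datatype nexp =
    NConst nat
  | NVar vname
  | NArr vname nexp
  | NPlus nexp nexp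
  | NMinus nexp nexp
  | NHalf nexp

datatype rexp =
    RVar vname
  | RArr vname nexp
  | RPlus rexp rexp
  | RMinus rexp rexp

datatype bexp =
    NLess nexp nexp
  | RLess rexp rexp
  | BNot bexp
  | BAnd bexp bexp

datatype com =
    Skip
  | NAssign vname nexp
  | NStore vname nexp nexp
  | RAssign vname rexp
  | RStore vname nexp rexp
  | Seq com com
  | Cond bexp com com
  | Loop bexp com

record store =
  nvar :: "vname \<Rightarrow> nat"
  narr :: "vname \<Rightarrow> nat \<Rightarrow> nat"
  rvar :: "vname \<Rightarrow> real"
  rarr :: "vname \<Rightarrow> nat \<Rightarrow> real"

fun nval :: "nexp \<Rightarrow> store \<Rightarrow> nat" where
  "nval (NConst m) s = m"
| "nval (NVar x) s = nvar s x"
| "nval (NArr a e) s = narr s a (nval e s)"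
| "nval (NPlus e f) s = nval e s + nval f s"
| "nval (NMinus e f) s = nval e s - nval f s"
| "nval (NHalf e) s = nval e s div 2"

fun rval :: "rexp \<Rightarrow> store \<Rightarrow> real" where
  "rval (RVar x) s = rvar s x"
| "rval (RArr a e) s = rarr s a (nval e s)"
| "rval (RPlus e f) s = rval e s + rval f s"
| "rval (RMinus e f) s = rval e s - rval f s"

fun bval :: "bexp \<Rightarrow> store \<Rightarrow> bool" where
  "bval (NLess e f) s \<longleftrightarrow> nval e s < nval f s"
| "bval (RLess e f) s \<longleftrightarrow> rval e s < rval f s"
| "bval (BNot p) s \<longleftrightarrow> \<not> bval p s"
| "bval (BAnd p q) s \<longleftrightarrow> bval p s \<and> bval q s"

fun ncost :: "nexp \<Rightarrow> nat" where
  "ncost (NConst m) = 1"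
| "ncost (NVar x) = 1"
| "ncost (NArr a e) = ncost e + 1"
| "ncost (NPlus e f) = ncost e + ncost f + 1"
| "ncost (NMinus e f) = ncost e + ncost f + 1"
| "ncost (NHalf e) = ncost e + 1"

fun rcost :: "rexp \<Rightarrow> nat" where
  "rcost (RVar x) = 1"
| "rcost (RArr a e) = ncost e + 1"
| "rcost (RPlus e f) = rcost e + rcost f + 1"
| "rcost (RMinus e f) = rcost e + rcost f + 1"

fun bcost :: "bexp \<Rightarrow> nat" where
  "bcost (NLess e f) = ncost e + ncost f + 1"
| "bcost (RLess e f) = rcost e + rcost f + 1"
| "bcost (BNot p) = bcost p + 1"
| "bcost (BAnd p q) = bcost p + bcost q + 1"

text \<open>\<open>exec c s t s'\<close>: started in \<open>s\<close>, program \<open>c\<close> halts in \<open>s'\<close> after \<open>t\<close> time units.\<close>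

inductive exec :: "com \<Rightarrow> store \<Rightarrow> nat \<Rightarrow> store \<Rightarrow> bool" where
  Skip: "exec Skip s 1 s"
| NAssign: "exec (NAssign x e) s (ncost e + 1) (s\<lparr>nvar := (nvar s)(x := nval e s)\<rparr>)"
| NStore: "exec (NStore a i e) s (ncost i + ncost e + 1)
    (s\<lparr>narr := (narr s)(a := (narr s a)(nval i s := nval e s))\<rparr>)"
| RAssign: "exec (RAssign x e) s (rcost e + 1) (s\<lparr>rvar := (rvar s)(x := rval e s)\<rparr>)"
| RStore: "exec (RStore a i e) s (ncost i + rcost e + 1)
    (s\<lparr>rarr := (rarr s)(a := (rarr s a)(nval i s := rval e s))\<rparr>)"
| Seq: "exec c s t s' \<Longrightarrow> exec c' s' t' s'' \<Longrightarrow> exec (Seq c c') s (t + t') s''"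
| CondTrue: "bval p s \<Longrightarrow> exec c s t s' \<Longrightarrow> exec (Cond p c c') s (bcost p + 1 + t) s'"
| CondFalse: "\<not> bval p s \<Longrightarrow> exec c' s t s' \<Longrightarrow> exec (Cond p c c') s (bcost p + 1 + t) s'"
| LoopFalse: "\<not> bval p s \<Longrightarrow> exec (Loop p c) s (bcost p + 1) s"
| LoopTrue: "bval p s \<Longrightarrow> exec c s t s' \<Longrightarrow> exec (Loop p c) s' t' s'' \<Longrightarrow>
    exec (Loop p c) s (bcost p + 1 + t + t') s''"

inductive_cases exec_SkipE: "exec Skip s t s'"
inductive_cases exec_NAssignE: "exec (NAssign x e) s t s'"
inductive_cases exec_NStoreE: "exec (NStore a i e) s t s'"
inductive_cases exec_RAssignE: "exec (RAssign x e) s t s'"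
inductive_cases exec_RStoreE: "exec (RStore a i e) s t s'"
inductive_cases exec_SeqE: "exec (Seq c c') s t s'"
inductive_cases exec_CondE: "exec (Cond p c c') s t s'"
inductive_cases exec_LoopE: "exec (Loop p c) s t s'"

lemma exec_deterministic:
  assumes "exec c s t s'" and "exec c s u s''"
  shows "t = u \<and> s' = s''"
  using assms
proof (induction arbitrary: u s'' rule: exec.induct)
  case (Skip s)
  from Skip.prems show ?case by (rule exec_SkipE) simp
next
  case (NAssign x e s)
  from NAssign.prems show ?case by (rule exec_NAssignE) simp
next
  case (NStore a i e s)
  from NStore.prems show ?case by (rule exec_NStoreE) simp
next
  case (RAssign x e s)
  from RAssign.prems show ?case by (rule exec_RAssignE) simp
next
  case (RStore a i e s)
  from RStore.prems show ?case by (rule exec_RStoreE) simp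
next
  case (Seq c s t s' c' t' s3)
  from Seq.prems show ?case by (rule exec_SeqE) (metis Seq.IH)
next
  case (CondTrue p s c t s' c')
  from CondTrue.prems show ?case by (rule exec_CondE; auto simp: CondTrue.hyps(1) dest!: CondTrue.IH)
next
  case (CondFalse p s c' t s' c)
  from CondFalse.prems show ?case by (rule exec_CondE; auto simp: CondFalse.hyps(1) dest!: CondFalse.IH)
next
  case (LoopFalse p s c)
  from LoopFalse.prems show ?case by (rule exec_LoopE) (simp_all add: LoopFalse.hyps)
next
  case (LoopTrue p s c t s' t' s3)
  from LoopTrue.prems show ?case by (rule exec_LoopE; auto simp: LoopTrue.hyps(1) dest!: LoopTrue.IH)
qed

text \<open>
  The points are presented through an enumeration \<open>pt\<close>, a bijection from \<open>{..<card X}\<close> to \<open>X\<close>;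
  the program only sees indices. The distance matrix is stored row by row, sets of centers
  are stored as characteristic vectors.
\<close>

definition index_of :: "'a set \<Rightarrow> (nat \<Rightarrow> 'a) \<Rightarrow> 'a \<Rightarrow> nat" where
  "index_of X pt = the_inv_into {..<card X} pt"

definition lc_input ::
  "'a set \<Rightarrow> ('a \<Rightarrow> 'a \<Rightarrow> real) \<Rightarrow> (nat \<Rightarrow> 'a) \<Rightarrow> nat \<Rightarrow> nat \<Rightarrow> 'a clustering \<Rightarrow> store" where
  "lc_input X d pt k b \<H> = (let n = card X in
     \<lparr> nvar = (\<lambda>_. 0)(''n'' := n, ''k'' := k, ''b'' := b),
       narr = (\<lambda>_ _. 0)(
         ''H'' := (\<lambda>i. if i < n \<and> pt i \<in> fst \<H> then 1 else 0),
         ''lH'' := (\<lambda>i. if i < n then index_of X pt (snd \<H> (pt i)) else 0)),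
       rvar = (\<lambda>_. 0),
       rarr = (\<lambda>_ _. 0)(
         ''d'' := (\<lambda>m. if m < n * n then d (pt (m div n)) (pt (m mod n)) else 0)) \<rparr>)"

definition lc_output :: "'a set \<Rightarrow> (nat \<Rightarrow> 'a) \<Rightarrow> store \<Rightarrow> 'a clustering" where
  "lc_output X pt s =
     (pt ` {i \<in> {..<card X}. narr s ''C'' i \<noteq> 0},
      \<lambda>x. pt (narr s ''lC'' (index_of X pt x)))"

end

theory Submission
  imports Defs
begin

text \<open>
  For a guessed radius \<open>r\<close>, choose greedily a maximal set \<open>S\<close> of points at pairwise distance more
  than \<open>2r\<close>. A solution of cost at most \<open>r\<close> has a center within \<open>r\<close> of every \<open>s \<in> S\<close>, and these
  centers are distinct, so \<open>|S| \<le> k\<close>. Weigh a historical center \<open>h\<close> by the number of points within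
  \<open>r\<close> of \<open>h\<close> that carry the label \<open>h\<close>, that is, by the number of labels that keeping \<open>h\<close> preserves.
  For each \<open>s \<in> S\<close>, take the heaviest historical center within \<open>r\<close> of \<open>s\<close>, or \<open>s\<close> itself if there
  is none, and fill the remaining \<open>k - |S|\<close> places with the heaviest remaining historical centers.
  By an exchange argument no solution of cost at most \<open>r\<close> preserves more labels. Every other point is
  within \<open>2r\<close> of some \<open>s \<in> S\<close>, hence within \<open>3r\<close> of the center chosen for \<open>s\<close>. The optimal cost is
  one of the \<open>n\<^sup>2\<close> distances, and binary search over the sorted distances needs \<open>O(log n)\<close> guesses,
  each taking time \<open>O(n\<^sup>2)\<close>; as \<open>k \<le> n\<close>, sorting and searching both take \<open>O(n\<^sup>2 log n)\<close>.
\<close>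

section \<open>Timed total correctness\<close>

text \<open>The exchange argument compares with an arbitrary solution of cost at most
  \<open>r\<close>, through \<open>K\<close>, the historical centers that it keeps. Every label that
  it preserves lies within \<open>r\<close> of its center, so the weights over \<open>K\<close>
  bound what it preserves. A point of \<open>S\<close> with no member of \<open>K\<close> within
  \<open>r\<close> is served by a center outside \<open>H\<close>, and these centers are distinct;
  hence, once one member of \<open>K\<close> has been matched to each remaining point of
  \<open>S\<close>, at most \<open>k - |S|\<close> members of \<open>K\<close> are left over. The
  matched ones are outweighed by the centers chosen for the same points, the others by the heaviest
  fillers. The matching must prefer the chosen center itself whenever \<open>K\<close> contains it,
  since otherwise a leftover could coincide with a chosen center and would not compete with the
  fillers. The time bound is read off the nesting depth of the loops, so the program is shaped by
  that depth: a merge pass is one flat loop over the \<open>n * n\<close> entries, a probe nests at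
  most two loops over the \<open>n\<close> points, and only the logarithmically many passes and
  probes are counted by hand.\<close>

definition runs :: "com \<Rightarrow> store \<Rightarrow> nat \<Rightarrow> (store \<Rightarrow> bool) \<Rightarrow> bool" where
  "runs c s T Q \<longleftrightarrow> (\<exists>t s'. exec c s t s' \<and> t \<le> T \<and> Q s')"

section \<open>Frames: what a program cannot change\<close>

fun written_nvar :: "com \<Rightarrow> vname set" where
  "written_nvar (NAssign x e) = {x}"
| "written_nvar (Seq c c') = written_nvar c \<union> written_nvar c'"
| "written_nvar (Cond p c c') = written_nvar c \<union> written_nvar c'"
| "written_nvar (Loop p c) = written_nvar c"
| "written_nvar _ = {}"

fun written_narr :: "com \<Rightarrow> vname set" where
  "written_narr (NStore x i e) = {x}"
| "written_narr (Seq c c') = written_narr c \<union> written_narr c'"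
| "written_narr (Cond p c c') = written_narr c \<union> written_narr c'"
| "written_narr (Loop p c) = written_narr c"
| "written_narr _ = {}"

fun written_rvar :: "com \<Rightarrow> vname set" where
  "written_rvar (RAssign x e) = {x}"
| "written_rvar (Seq c c') = written_rvar c \<union> written_rvar c'"
| "written_rvar (Cond p c c') = written_rvar c \<union> written_rvar c'"
| "written_rvar (Loop p c) = written_rvar c"
| "written_rvar _ = {}"

fun written_rarr :: "com \<Rightarrow> vname set" where
  "written_rarr (RStore x i e) = {x}"
| "written_rarr (Seq c c') = written_rarr c \<union> written_rarr c'"
| "written_rarr (Cond p c c') = written_rarr c \<union> written_rarr c'"
| "written_rarr (Loop p c) = written_rarr c"
| "written_rarr _ = {}"

text \<open>A frame condition read off the syntax. The rules below supply it to invariants and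
  postconditions for free, so that these only have to describe what changes.\<close>

definition agree :: "com \<Rightarrow> store \<Rightarrow> store \<Rightarrow> bool" where
  "agree c s s' \<longleftrightarrow>
     (\<forall>x. x \<notin> written_nvar c \<longrightarrow> nvar s' x = nvar s x) \<and>
     (\<forall>x. x \<notin> written_narr c \<longrightarrow> narr s' x = narr s x) \<and>
     (\<forall>x. x \<notin> written_rvar c \<longrightarrow> rvar s' x = rvar s x) \<and>
     (\<forall>x. x \<notin> written_rarr c \<longrightarrow> rarr s' x = rarr s x)"

lemma agree_nvar: "agree c s s' \<Longrightarrow> x \<notin> written_nvar c \<Longrightarrow> nvar s' x = nvar s x"
  and agree_narr: "agree c s s' \<Longrightarrow> x \<notin> written_narr c \<Longrightarrow> narr s' x = narr s x"
  and agree_rvar: "agree c s s' \<Longrightarrow> x \<notin> written_rvar c \<Longrightarrow> rvar s' x = rvar s x"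
  and agree_rarr: "agree c s s' \<Longrightarrow> x \<notin> written_rarr c \<Longrightarrow> rarr s' x = rarr s x"
  by (auto simp: agree_def)

lemmas agreeD = agree_nvar agree_narr agree_rvar agree_rarr

lemma agree_refl: "agree c s s"
  by (simp add: agree_def)

lemma agree_trans: "agree c s s' \<Longrightarrow> agree c s' s'' \<Longrightarrow> agree c s s''"
  by (simp add: agree_def)

lemma exec_agree: "exec c s t s' \<Longrightarrow> agree c s s'"
  by (induction rule: exec.induct) (auto simp: agree_def)

lemma runs_mono:
  assumes "runs c s T Q" "T \<le> T'" "\<And>s'. agree c s s' \<Longrightarrow> Q s' \<Longrightarrow> Q' s'"
  shows "runs c s T' Q'"
  using assms exec_agree unfolding runs_def by (meson order_trans)

lemma runs_Seq:
  assumes "runs c s T (\<lambda>s'. runs c' s' T' Q)"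
  shows "runs (Seq c c') s (T + T') Q"
  using assms unfolding runs_def by (meson add_mono exec.Seq)

lemma runs_Cond:
  assumes "bval p s \<Longrightarrow> runs c s T Q" "\<not> bval p s \<Longrightarrow> runs c' s T' Q"
  shows "runs (Cond p c c') s (bcost p + 1 + T + T') Q"
proof (cases "bval p s")
  case True
  with assms(1) obtain t s' where "exec c s t s'" "t \<le> T" "Q s'" by (auto simp: runs_def)
  with True show ?thesis unfolding runs_def
    by (intro exI[of _ "bcost p + 1 + t"] exI[of _ s']) (use exec.CondTrue[of p s c t s' c'] in auto)
next
  case False
  with assms(2) obtain t s' where "exec c' s t s'" "t \<le> T'" "Q s'" by (auto simp: runs_def)
  with False show ?thesis unfolding runs_def
    by (intro exI[of _ "bcost p + 1 + t"] exI[of _ s']) (use exec.CondFalse[of p s c' t s' c] in auto)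
qed

text \<open>The index \<open>m\<close> of the invariant bounds the number of iterations that remain.\<close>

lemma runs_Loop:
  assumes "I m s"
    and step: "\<And>m s'. I m s' \<Longrightarrow> bval p s' \<Longrightarrow> agree c s s' \<Longrightarrow>
      \<exists>m'. m = Suc m' \<and> runs c s' B (I m')"
  shows "runs (Loop p c) s (m * (bcost p + 1 + B) + (bcost p + 1))
    (\<lambda>s'. (\<exists>m'. I m' s') \<and> \<not> bval p s')"
proof -
  have "runs (Loop p c) s' (m * (bcost p + 1 + B) + (bcost p + 1))
      (\<lambda>s'. (\<exists>m'. I m' s') \<and> \<not> bval p s')" if "I m s'" "agree c s s'" for s'
    using that
  proof (induction m arbitrary: s')
    case 0
    \<comment> \<open>With a true guard, \<open>step\<close> would ask for a predecessor of
      0.\<close>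
    then have "\<not> bval p s'" using step by blast
    with 0 show ?case unfolding runs_def using exec.LoopFalse by fastforce
  next
    case (Suc m)
    show ?case
    proof (cases "bval p s'")
      case True
      then have "runs c s' B (I m)" using step Suc.prems by blast
      then obtain t s1 where 1: "exec c s' t s1" "t \<le> B" "I m s1"
        unfolding runs_def by blast
      have "agree c s s1" using Suc.prems(2) exec_agree[OF 1(1)] agree_trans by blast
      from Suc.IH[OF 1(3) this] obtain t' s2 where
        2: "exec (Loop p c) s1 t' s2" "t' \<le> m * (bcost p + 1 + B) + (bcost p + 1)"
           "(\<exists>m'. I m' s2) \<and> \<not> bval p s2"
        unfolding runs_def by blast
      show ?thesis unfolding runs_def
        by (rule exI, rule exI, rule conjI[OF exec.LoopTrue[OF True 1(1) 2(1)]])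
          (use 1 2 in auto)
    next
      case False
      have "exec (Loop p c) s' (bcost p + 1) s'" using False by (rule exec.LoopFalse)
      moreover have "bcost p + 1 \<le> Suc m * (bcost p + 1 + B) + (bcost p + 1)" by simp
      ultimately show ?thesis unfolding runs_def using False Suc.prems(1) by blast
    qed
  qed
  from this[OF assms(1) agree_refl] show ?thesis .
qed

text \<open>The running time of a program each of whose loops iterates at most \<open>m\<close> times per entry.\<close>

fun time_bound :: "nat \<Rightarrow> com \<Rightarrow> nat" where
  "time_bound m Skip = 1"
| "time_bound m (NAssign x e) = ncost e + 1"
| "time_bound m (NStore a i e) = ncost i + ncost e + 1"
| "time_bound m (RAssign x e) = rcost e + 1"
| "time_bound m (RStore a i e) = ncost i + rcost e + 1"
| "time_bound m (Seq c c') = time_bound m c + time_bound m c'"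
| "time_bound m (Cond p c c') = bcost p + 1 + time_bound m c + time_bound m c'"
| "time_bound m (Loop p c) = m * (bcost p + 1 + time_bound m c) + (bcost p + 1)"

text \<open>With the allowance fixed by the syntax, the rules carry no time arithmetic; what remains
  to be shown is that no loop exceeds \<open>m\<close> iterations per entry.\<close>

definition bounded_run :: "nat \<Rightarrow> com \<Rightarrow> store \<Rightarrow> (store \<Rightarrow> bool) \<Rightarrow> bool" where
  "bounded_run m c s Q \<longleftrightarrow> runs c s (time_bound m c) Q"

fun loop_free :: "com \<Rightarrow> bool" where
  "loop_free (Seq c c') \<longleftrightarrow> loop_free c \<and> loop_free c'"
| "loop_free (Cond p c c') \<longleftrightarrow> loop_free c \<and> loop_free c'"
| "loop_free (Loop p c) \<longleftrightarrow> False"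
| "loop_free _ \<longleftrightarrow> True"

text \<open>Lets the simplifier execute loop-free code symbolically. The value at a loop is a dummy,
  as \<open>result\<close> is only applied under \<open>loop_free\<close>.\<close>

fun result :: "com \<Rightarrow> store \<Rightarrow> store" where
  "result (NAssign x e) s = s\<lparr>nvar := (nvar s)(x := nval e s)\<rparr>"
| "result (NStore a i e) s = s\<lparr>narr := (narr s)(a := (narr s a)(nval i s := nval e s))\<rparr>"
| "result (RAssign x e) s = s\<lparr>rvar := (rvar s)(x := rval e s)\<rparr>"
| "result (RStore a i e) s = s\<lparr>rarr := (rarr s)(a := (rarr s a)(nval i s := rval e s))\<rparr>"
| "result (Seq c c') s = result c' (result c s)"
| "result (Cond p c c') s = (if bval p s then result c s else result c' s)"
| "result _ s = s"

lemma bounded_run_mono: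
  assumes "bounded_run m c s Q" "\<And>s'. agree c s s' \<Longrightarrow> Q s' \<Longrightarrow> Q' s'"
  shows "bounded_run m c s Q'"
  using assms runs_mono unfolding bounded_run_def by blast

lemma bounded_run_Seq: "bounded_run m c s (\<lambda>s'. bounded_run m c' s' Q) \<Longrightarrow> bounded_run m (Seq c c') s Q"
  unfolding bounded_run_def by (simp add: runs_Seq)

lemma bounded_run_Cond:
  assumes "bval p s \<Longrightarrow> bounded_run m c s Q" "\<not> bval p s \<Longrightarrow> bounded_run m c' s Q"
  shows "bounded_run m (Cond p c c') s Q"
  using runs_Cond[of p s c _ Q c'] assms unfolding bounded_run_def by simp

lemma loop_free_runs: "loop_free c \<Longrightarrow> runs c s (time_bound m c) (\<lambda>s'. s' = result c s)"
proof (induction c arbitrary: s)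
  case (Seq c c')
  have "runs c s (time_bound m c) (\<lambda>s'. runs c' s' (time_bound m c') (\<lambda>s''. s'' = result (Seq c c') s))"
    by (rule runs_mono[OF Seq.IH(1)]) (use Seq in auto)
  then show ?case using runs_Seq by simp
next
  case (Cond p c c')
  have "runs (Cond p c c') s (bcost p + 1 + time_bound m c + time_bound m c')
      (\<lambda>s'. s' = result (Cond p c c') s)"
    by (rule runs_Cond; rule runs_mono) (use Cond in auto)
  then show ?case by simp
next
  case Skip
  show ?case unfolding runs_def using exec.Skip by fastforce
next
  case (NAssign x e)
  show ?case unfolding runs_def using exec.NAssign by fastforce
next
  case (NStore x i e)
  show ?case unfolding runs_def using exec.NStore by fastforce
next
  case (RAssign x e)
  show ?case unfolding runs_def using exec.RAssign by fastforce
next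
  case (RStore x i e)
  show ?case unfolding runs_def using exec.RStore by fastforce
qed simp

lemma bounded_run_loop_free: "loop_free c \<Longrightarrow> Q (result c s) \<Longrightarrow> bounded_run m c s Q"
  unfolding bounded_run_def using loop_free_runs[of c s m] by (auto simp: runs_def)

definition For :: "vname \<Rightarrow> vname \<Rightarrow> com \<Rightarrow> com" where
  "For i l c = Seq (NAssign i (NConst 0))
     (Loop (NLess (NVar i) (NVar l)) (Seq c (NAssign i (NPlus (NVar i) (NConst 1)))))"

lemma written_For [simp]:
  "written_nvar (For i l c) = insert i (written_nvar c)"
  "written_narr (For i l c) = written_narr c"
  "written_rvar (For i l c) = written_rvar c"
  "written_rarr (For i l c) = written_rarr c"
  by (auto simp: For_def)

abbreviation set_nvar :: "vname \<Rightarrow> nat \<Rightarrow> store \<Rightarrow> store" where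
  "set_nvar x v s \<equiv> s\<lparr>nvar := (nvar s)(x := v)\<rparr>"

text \<open>\<open>I j\<close> describes the state in which the counter already holds
  \<open>j\<close>; the increment is built into the rule, which is why the body has to establish its
  postcondition after \<open>set_nvar\<close>. The premise \<open>N \<le> m\<close> is the only
  place where an iteration count meets the time allowance.\<close>

lemma bounded_run_For:
  assumes N: "nvar s l = N" "N \<le> m" "l \<noteq> i" "l \<notin> written_nvar c" "i \<notin> written_nvar c"
    and init: "I 0 (set_nvar i 0 s)"
    and step: "\<And>j s'. j < N \<Longrightarrow> I j s' \<Longrightarrow> nvar s' i = j \<Longrightarrow> agree (For i l c) s s' \<Longrightarrow>
      bounded_run m c s' (\<lambda>s''. I (Suc j) (set_nvar i (Suc j) s''))"
    and post: "\<And>s'. I N s' \<Longrightarrow> agree (For i l c) s s' \<Longrightarrow> Q s'"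
  shows "bounded_run m (For i l c) s Q"
proof -
  let ?p = "NLess (NVar i) (NVar l)" and ?c = "Seq c (NAssign i (NPlus (NVar i) (NConst 1)))"
  let ?s = "set_nvar i 0 s"
  \<comment> \<open>\<open>runs_Loop\<close> counts remaining iterations, \<open>I\<close> counts
    completed ones. The conjunct \<open>r \<le> N\<close> keeps the truncated difference
    honest.\<close>
  define J where "J r s' \<longleftrightarrow> nvar s' i = N - r \<and> r \<le> N \<and> I (N - r) s'" for r s'
  have ag: "agree (For i l c) s s'" if "agree ?c ?s s'" for s'
    using that by (auto simp: agree_def)
  have "runs (Loop ?p ?c) ?s (N * (bcost ?p + 1 + time_bound m ?c) + (bcost ?p + 1))
    (\<lambda>s'. (\<exists>r. J r s') \<and> \<not> bval ?p s')"
  proof (rule runs_Loop)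
    show "J N ?s" using init by (simp add: J_def)
    fix r s' assume J: "J r s'" and p: "bval ?p s'" and a: "agree ?c ?s s'"
    have l: "nvar s' l = N" using agreeD(1)[OF a, of l] N by simp
    obtain q where q: "r = Suc q" using J p l by (cases r) (auto simp: J_def)
    let ?j = "N - r"
    have "bounded_run m c s' (\<lambda>s''. I (Suc ?j) (set_nvar i (Suc ?j) s''))"
      by (rule step) (use J ag[OF a] q in \<open>auto simp: J_def\<close>)
    then have "bounded_run m c s' (\<lambda>s''. bounded_run m (NAssign i (NPlus (NVar i) (NConst 1))) s'' (J q))"
    proof (rule bounded_run_mono)
      fix s'' assume a': "agree c s' s''" and I: "I (Suc ?j) (set_nvar i (Suc ?j) s'')"
      have "nvar s'' i = ?j" using agreeD(1)[OF a', of i] N J by (simp add: J_def)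
      moreover have "Suc ?j = N - q" using q J by (auto simp: J_def)
      ultimately show "bounded_run m (NAssign i (NPlus (NVar i) (NConst 1))) s'' (J q)"
        using I q J by (intro bounded_run_loop_free) (auto simp: J_def)
    qed
    then have "bounded_run m ?c s' (J q)" by (rule bounded_run_Seq)
    then show "\<exists>q. r = Suc q \<and> runs ?c s' (time_bound m ?c) (J q)"
      using q by (auto simp: bounded_run_def)
  qed
  then have "runs (Loop ?p ?c) ?s (time_bound m (Loop ?p ?c)) Q"
  proof (rule runs_mono)
    show "N * (bcost ?p + 1 + time_bound m ?c) + (bcost ?p + 1) \<le> time_bound m (Loop ?p ?c)"
      using N(2) by (simp only: time_bound.simps add_le_mono mult_le_mono le_refl)
    fix s' assume a: "agree (Loop ?p ?c) ?s s'" and *: "(\<exists>r. J r s') \<and> \<not> bval ?p s'"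
    have a': "agree ?c ?s s'" using a by (simp add: agree_def)
    have l: "nvar s' l = N" using agreeD(1)[OF a', of l] N by simp
    from * obtain r where r: "J r s'" "\<not> bval ?p s'" by blast
    with l have "N - r = N" by (simp add: J_def)
    with r have "I N s'" by (simp add: J_def)
    then show "Q s'" using post ag[OF a'] by blast
  qed
  then have "bounded_run m (Loop ?p ?c) (result (NAssign i (NConst 0)) s) Q"
    unfolding bounded_run_def by (simp only: result.simps nval.simps)
  then show ?thesis unfolding For_def
    by (intro bounded_run_Seq bounded_run_loop_free[of "NAssign i (NConst 0)"]) simp_all
qed

section \<open>Correctness of the greedy selection\<close>

text \<open>After cancelling \<open>F \<inter> E\<close>, the least weight in \<open>E - F\<close>
  is a threshold: \<open>F - E\<close> has no more elements than \<open>E - F\<close>, and none of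
  them weighs more than the threshold.\<close>

lemma sum_le_sum_heaviest:
  fixes w :: "'a \<Rightarrow> nat"
  assumes fin: "finite R" and sub: "E \<subseteq> R" "F \<subseteq> R" and card: "card F \<le> card E"
    and top: "\<And>x y. x \<in> E \<Longrightarrow> y \<in> R - E \<Longrightarrow> w y \<le> w x"
  shows "sum w F \<le> sum w E"
proof -
  have finEF: "finite E" "finite F" using fin sub finite_subset by blast+
  have c: "card (F - E) \<le> card (E - F)"
    using card finEF card_Int_Diff[of F E] card_Int_Diff[of E F] by (simp add: Int_commute)
  have "sum w (F - E) \<le> sum w (E - F)"
  proof (cases "E - F = {}")
    case True
    then have "card (F - E) = 0" using c by (metis card.empty le_zero_eq)
    then have "F - E = {}" using finEF by simp
    then show ?thesis by (simp only: sum.empty le0)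
  next
    case False
    define v where "v = Min (w ` (E - F))"
    have v: "v \<le> w x" if "x \<in> E - F" for x using that finEF by (auto simp: v_def)
    have "v \<in> w ` (E - F)" unfolding v_def using False finEF by (intro Min_in) auto
    then have u: "w y \<le> v" if "y \<in> F - E" for y using that top sub by blast
    have "sum w (F - E) \<le> card (F - E) * v" using u sum_bounded_above[of "F - E" w v] by simp
    also have "\<dots> \<le> card (E - F) * v" using c by simp
    also have "\<dots> \<le> sum w (E - F)" using v sum_bounded_below[of "E - F" v w] by simp
    finally show ?thesis .
  qed
  moreover have "sum w F = sum w (F \<inter> E) + sum w (F - E)" "sum w E = sum w (F \<inter> E) + sum w (E - F)"
    using finEF by (simp_all add: sum.Int_Diff[of F w E] sum.Int_Diff[of E w F] Int_commute)
  ultimately show ?thesis by simp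
qed

text \<open>The instance as the program sees it. \<open>Metric_space\<close> grants nonnegativity
  and symmetry everywhere but the other axioms only on the carrier, and the index bounds follow this
  pattern.\<close>

locale indexed_instance =
  fixes n k b :: nat and D :: "nat \<Rightarrow> nat \<Rightarrow> real" and H :: "nat set" and lH :: "nat \<Rightarrow> nat"
  assumes H_sub: "H \<subseteq> {..<n}" and card_H: "card H = k" and lH: "\<And>i. i < n \<Longrightarrow> lH i \<in> H"
    and D_nonneg: "\<And>i j. 0 \<le> D i j"
    and D_refl: "\<And>i. i < n \<Longrightarrow> D i i = 0"
    and D_sym: "\<And>i j. D i j = D j i"
    and D_triangle: "\<And>i j l. i < n \<Longrightarrow> j < n \<Longrightarrow> l < n \<Longrightarrow> D i l \<le> D i j + D j l"
begin

definition feasible :: "nat set \<Rightarrow> (nat \<Rightarrow> nat) \<Rightarrow> bool" where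
  "feasible C l \<longleftrightarrow> C \<subseteq> {..<n} \<and> card C = k \<and> (\<forall>i<n. l i \<in> C) \<and> card {i. i < n \<and> lH i \<noteq> l i} \<le> b"

definition cost_le :: "real \<Rightarrow> (nat \<Rightarrow> nat) \<Rightarrow> bool" where
  "cost_le r l \<longleftrightarrow> (\<forall>i<n. D i (l i) \<le> r)"

definition weight :: "real \<Rightarrow> nat \<Rightarrow> nat" where
  "weight r h = card {x. x < n \<and> lH x = h \<and> D x h \<le> r}"

text \<open>A relation rather than a function, so that any way of breaking ties satisfies
  it.\<close>

definition best_center :: "real \<Rightarrow> nat \<Rightarrow> nat \<Rightarrow> bool" where
  "best_center r s c \<longleftrightarrow>
     (if \<exists>h\<in>H. D s h \<le> r
      then c \<in> H \<and> D s c \<le> r \<and> (\<forall>h\<in>H. D s h \<le> r \<longrightarrow> weight r h \<le> weight r c)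
      else c = s)"

text \<open>Strictness makes closed balls of radius \<open>r\<close> disjoint, while a point refused
  by the greedy choice is still within \<open>2 * r\<close> of a chosen one.\<close>

definition separated :: "real \<Rightarrow> nat set \<Rightarrow> bool" where
  "separated r S \<longleftrightarrow> S \<subseteq> {..<n} \<and> (\<forall>s\<in>S. \<forall>t\<in>S. s \<noteq> t \<longrightarrow> 2 * r < D s t)"

text \<open>The size of \<open>E\<close> is left open, so that the same predicate is the invariant
  while \<open>E\<close> grows one element at a time.\<close>

definition heaviest :: "real \<Rightarrow> nat set \<Rightarrow> nat set \<Rightarrow> bool" where
  "heaviest r R E \<longleftrightarrow> E \<subseteq> R \<and> (\<forall>x\<in>E. \<forall>y\<in>R - E. weight r y \<le> weight r x)"

lemma finite_H: "finite H"
  using H_sub finite_subset by blast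

lemma k_le_n: "k \<le> n"
  using H_sub card_H card_mono[of "{..<n}" H] by simp

text \<open>Every point carries one label, so the sets counted by the weights are disjoint. This
  turns weights into numbers of preserved labels.\<close>

lemma sum_weight:
  assumes "finite K"
  shows "sum (weight r) K = card {x. x < n \<and> lH x \<in> K \<and> D x (lH x) \<le> r}"
proof -
  have "{x. x < n \<and> lH x \<in> K \<and> D x (lH x) \<le> r} = (\<Union>h\<in>K. {x. x < n \<and> lH x = h \<and> D x h \<le> r})"
    by auto
  also have "card \<dots> = sum (weight r) K"
    unfolding weight_def by (rule card_UN_disjoint) (use assms in auto)
  finally show ?thesis by simp
qed

lemma best_center_near:
  assumes "best_center r s c" "s < n" "0 \<le> r"
  shows "c < n" "D s c \<le> r"
  using assms H_sub D_refl unfolding best_center_def by (auto split: if_splits)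

text \<open>By the triangle inequality, no point lies within \<open>r\<close> of two separated
  points. Applied below to the chosen centers, to the matched historical centers of a competitor and
  to its labeling.\<close>

lemma separated_inj_on:
  assumes S: "separated r S" and T: "T \<subseteq> S" and f: "\<And>s. s \<in> T \<Longrightarrow> f s < n \<and> D s (f s) \<le> r"
  shows "inj_on f T"
proof (rule inj_onI, rule ccontr)
  fix s t assume st: "s \<in> T" "t \<in> T" "f s = f t" "s \<noteq> t"
  have "D s t \<le> D s (f s) + D (f s) t"
    using st S T f by (intro D_triangle) (auto simp: separated_def)
  also have "\<dots> \<le> r + r" using f[OF st(1)] f[OF st(2)] st(3) D_sym[of "f s" t] by simp
  finally have "D s t \<le> 2 * r" by simp
  moreover have "2 * r < D s t" using S T st unfolding separated_def by blast
  ultimately show False by simp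
qed

lemma card_separated_le:
  assumes "separated r S" "feasible C l" "cost_le r l"
  shows "card S \<le> k"
proof -
  have S: "S \<subseteq> {..<n}" using assms(1) by (simp add: separated_def)
  have "inj_on l S"
    by (rule separated_inj_on[OF assms(1)]) (use assms S in \<open>auto simp: feasible_def cost_le_def\<close>)
  then have "card S \<le> card C"
    using assms S by (intro card_inj_on_le[of l]) (auto simp: feasible_def finite_subset)
  then show ?thesis using assms by (simp add: feasible_def)
qed

text \<open>The conclusion says that at most \<open>b\<close> labels are lost, in additive form to
  avoid truncated subtraction; the right-hand sum is the number of labels that the greedy selection
  preserves.\<close>

lemma kept_weight_maximal:
  assumes r: "0 \<le> r" and S: "separated r S" and cen: "\<And>s. s \<in> S \<Longrightarrow> best_center r s (cen s)"
    and E: "heaviest r (H - cen ` S) E" "card E = k - card S"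
    and C: "feasible C l" "cost_le r l"
  shows "n \<le> b + sum (weight r) ((cen ` S \<inter> H) \<union> E)"
proof -
  have Sn: "S \<subseteq> {..<n}" and finS: "finite S"
    using S finite_subset by (auto simp: separated_def)
  have Cn: "C \<subseteq> {..<n}" and cardC: "card C = k" and finC: "finite C"
    using C finite_subset by (auto simp: feasible_def)
  have ER: "E \<subseteq> H - cen ` S" using E by (simp add: heaviest_def)
  let ?w = "weight r"
  define K where "K = C \<inter> H"
  have finK: "finite K" using finC by (simp add: K_def)
  define S1 where "S1 = {s \<in> S. \<exists>h\<in>K. D s h \<le> r}"
  \<comment> \<open>Meaningful only on \<open>S1\<close>, where \<open>SOME\<close> has a witness.
    The first case is the preference for the chosen center.\<close>
  define p where "p s = (if cen s \<in> K then cen s else SOME h. h \<in> K \<and> D s h \<le> r)" for s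
  have finS1: "finite S1" using finS by (simp add: S1_def)
  have cenS: "cen s < n" "D s (cen s) \<le> r" if "s \<in> S" for s
    using best_center_near[OF cen[OF that]] that Sn r by auto
  have p: "p s \<in> K \<and> D s (p s) \<le> r" if "s \<in> S1" for s
  proof (cases "cen s \<in> K")
    case True
    then show ?thesis using cenS that by (simp add: p_def S1_def)
  next
    case False
    have "\<exists>h. h \<in> K \<and> D s h \<le> r" using that by (auto simp: S1_def)
    from someI_ex[OF this] show ?thesis using False by (simp add: p_def)
  qed
  \<comment> \<open>For \<open>s \<in> S1\<close> a historical center is near, so
    \<open>best_center\<close> is in its first branch and \<open>p s\<close> was among the
    candidates.\<close>
  have cen1: "cen s \<in> H" "?w (p s) \<le> ?w (cen s)" if "s \<in> S1" for s
    using cen[of s] p[OF that] that unfolding best_center_def S1_def K_def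
    by (auto split: if_splits)
  have inj_cen: "inj_on cen S" using separated_inj_on[OF S order_refl] cenS by blast
  have inj_p: "inj_on p S1"
    by (rule separated_inj_on[OF S]) (use p Cn in \<open>auto simp: S1_def K_def\<close>)
  have inj_l: "inj_on l (S - S1)"
    by (rule separated_inj_on[OF S]) (use C Sn Cn in \<open>auto simp: feasible_def cost_le_def\<close>)
  have "{x. x < n \<and> lH x = l x} \<subseteq> {x. x < n \<and> lH x \<in> K \<and> D x (lH x) \<le> r}"
    using C lH by (force simp: K_def feasible_def cost_le_def)
  then have "card {x. x < n \<and> lH x = l x} \<le> sum ?w K"
    unfolding sum_weight[OF finK] by (intro card_mono) auto
  moreover have "n = card {x. x < n \<and> lH x = l x} + card {x. x < n \<and> lH x \<noteq> l x}"
  proof -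
    have "{..<n} \<inter> {x. lH x = l x} = {x. x < n \<and> lH x = l x}"
      "{..<n} - {x. lH x = l x} = {x. x < n \<and> lH x \<noteq> l x}" by auto
    then show ?thesis using card_Int_Diff[of "{..<n}" "{x. lH x = l x}"] by simp
  qed
  ultimately have 1: "n \<le> b + sum ?w K" using C by (simp add: feasible_def)
  have "sum ?w (p ` S1) = (\<Sum>s\<in>S1. ?w (p s))" using inj_p by (simp add: sum.reindex)
  also have "\<dots> \<le> (\<Sum>s\<in>S1. ?w (cen s))" using cen1 by (intro sum_mono)
  also have "\<dots> = sum ?w (cen ` S1)"
    using inj_cen by (subst sum.reindex) (auto simp: S1_def intro: inj_on_subset)
  also have "\<dots> \<le> sum ?w (cen ` S \<inter> H)"
    using cen1 finS by (intro sum_mono2) (auto simp: S1_def)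
  finally have 2: "sum ?w (p ` S1) \<le> sum ?w (cen ` S \<inter> H)" .
  \<comment> \<open>If a leftover \<open>h\<close> were \<open>cen s\<close>, then
    \<open>s \<in> S1\<close> and \<open>p s = h\<close> by the first case of \<open>p\<close>, so
    \<open>h\<close> would have been matched.\<close>
  have sub: "K - p ` S1 \<subseteq> H - cen ` S"
  proof
    fix h assume h: "h \<in> K - p ` S1"
    have "h \<noteq> cen s" if "s \<in> S" for s
    proof
      assume hs: "h = cen s"
      then have "s \<in> S1" using h cenS that by (auto simp: S1_def)
      moreover have "p s = h" using hs h by (simp add: p_def)
      ultimately show False using h by blast
    qed
    then show "h \<in> H - cen ` S" using h by (auto simp: K_def)
  qed
  \<comment> \<open>A center \<open>l s\<close> in \<open>H\<close> would be a member of
    \<open>K\<close> within \<open>r\<close> of \<open>s\<close>, contrary to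
    \<open>s \<notin> S1\<close>.\<close>
  have "l ` (S - S1) \<subseteq> C - H"
  proof
    fix c assume "c \<in> l ` (S - S1)"
    then obtain s where s: "s \<in> S" "s \<notin> S1" "c = l s" by blast
    then have "c \<in> C" "D s c \<le> r" using C Sn by (auto simp: feasible_def cost_le_def)
    then show "c \<in> C - H" using s by (auto simp: S1_def K_def)
  qed
  then have "card (S - S1) \<le> card (C - H)"
    using inj_l finC by (intro card_inj_on_le[of l]) auto
  moreover have "card C = card K + card (C - H)"
    using card_Int_Diff[OF finC, of H] by (simp add: K_def)
  moreover have "card S = card S1 + card (S - S1)"
    using card_Int_Diff[OF finS, of S1] by (simp add: S1_def Int_absorb1)
  moreover have "card (K - p ` S1) = card K - card S1"
    using p inj_p finS1 by (subst card_Diff_subset) (auto simp: card_image)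
  \<comment> \<open>\<open>|K| - |S1| \<le> (k - |S - S1|) - |S1| = k - |S|\<close>.\<close>
  ultimately have "card (K - p ` S1) \<le> card E" using cardC E by simp
  then have 3: "sum ?w (K - p ` S1) \<le> sum ?w E"
    using sub E finite_H by (intro sum_le_sum_heaviest[of "H - cen ` S"]) (auto simp: heaviest_def)
  have "sum ?w K = sum ?w (p ` S1) + sum ?w (K - p ` S1)"
    using p finK by (subst sum.subset_diff[of "p ` S1" K]) auto
  also have "\<dots> \<le> sum ?w (cen ` S \<inter> H) + sum ?w E" using 2 3 by simp
  also have "\<dots> = sum ?w ((cen ` S \<inter> H) \<union> E)"
    using ER finS finite_H finite_subset[OF ER] by (intro sum.union_disjoint[symmetric]) auto
  finally show ?thesis using 1 by simp
qed

end

section \<open>Merge sort\<close>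

abbreviation sequential :: "com \<Rightarrow> com \<Rightarrow> com" (infixr ";;" 60) where
  "c ;; c' \<equiv> Seq c c'"

definition sorted_between :: "(nat \<Rightarrow> real) \<Rightarrow> nat \<Rightarrow> nat \<Rightarrow> bool" where
  "sorted_between A a b \<longleftrightarrow> (\<forall>p q. a \<le> p \<longrightarrow> p \<le> q \<longrightarrow> q < b \<longrightarrow> A p \<le> A q)"

text \<open>Vacuous for width 1 and full sortedness once \<open>N \<le> w\<close>: the two ends of
  the sorting loop.\<close>

definition block_sorted :: "nat \<Rightarrow> (nat \<Rightarrow> real) \<Rightarrow> nat \<Rightarrow> bool" where
  "block_sorted w A N \<longleftrightarrow> (\<forall>p q. p \<le> q \<longrightarrow> q < N \<longrightarrow> p div w = q div w \<longrightarrow> A p \<le> A q)"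

text \<open>
  State of a merge pass that has written \<open>B\<close> up to \<open>p\<close>: the blocks \<open>{a..<u}\<close> and \<open>{u..<e}\<close> of \<open>A\<close>
  are being merged, and the elements before \<open>i\<close> and \<open>j\<close>, respectively, have been consumed.
\<close>

definition merging ::
  "nat \<Rightarrow> nat \<Rightarrow> (nat \<Rightarrow> real) \<Rightarrow> (nat \<Rightarrow> real) \<Rightarrow> nat \<Rightarrow> nat \<Rightarrow> nat \<Rightarrow> nat \<Rightarrow> nat \<Rightarrow> nat \<Rightarrow> bool" where
  "merging N w A B a i u j e p \<longleftrightarrow>
     a \<le> i \<and> i \<le> u \<and> u \<le> j \<and> j \<le> e \<and> e \<le> N \<and> p + u = i + j \<and>
     a mod (2 * w) = 0 \<and> e \<le> a + 2 * w \<and> (e = N \<or> e mod (2 * w) = 0) \<and>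
     sorted_between A a u \<and> sorted_between A u e \<and> sorted_between B a p \<and>
     (\<forall>x q. a \<le> x \<and> x < p \<and> (i \<le> q \<and> q < u \<or> j \<le> q \<and> q < e) \<longrightarrow> B x \<le> A q) \<and>
     block_sorted (2 * w) B a \<and> A ` ({..<i} \<union> {u..<j}) = B ` {..<p}"

text \<open>An empty pair of blocks counts as used up, so the first step of a pass loads a real pair
  without special treatment.\<close>

lemma merging_init: "merging N w A B 0 0 0 0 0 0"
  by (simp add: merging_def sorted_between_def block_sorted_def)

lemma div_less_of_multiple:
  fixes a p q v :: nat
  assumes "a mod v = 0" "p < a" "a \<le> q" "0 < v"
  shows "p div v < q div v"
proof -
  obtain c where c: "a = c * v" using assms(1) by (metis mod_0_imp_dvd dvdE mult.commute)
  have "p div v < c" using assms c by (simp add: div_less_iff_less_mult)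
  moreover have "c \<le> q div v" using assms c by (simp add: less_eq_div_iff_mult_less_eq)
  ultimately show ?thesis by simp
qed

text \<open>With \<open>p = e\<close>, the balance \<open>p + u = i + j\<close> forces
  \<open>i = u\<close> and \<open>j = e\<close>. As \<open>a\<close> is a multiple of
  \<open>2 * w\<close>, no block of the doubled width straddles it.\<close>

lemma merging_block_done:
  assumes "merging N w A B a i u j e e" "0 < w"
  shows "block_sorted (2 * w) B e" "A ` {..<e} = B ` {..<e}"
proof -
  note m = assms(1)[unfolded merging_def]
  show "block_sorted (2 * w) B e"
    unfolding block_sorted_def
  proof (intro allI impI)
    fix p q assume pq: "p \<le> q" "q < e" "p div (2 * w) = q div (2 * w)"
    consider "q < a" | "a \<le> p" | "p < a" "a \<le> q" by linarith
    then show "B p \<le> B q"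
    proof cases
      case 1 then show ?thesis using m pq by (auto simp: block_sorted_def)
    next
      case 2 then show ?thesis using m pq by (auto simp: sorted_between_def)
    next
      case 3 then show ?thesis using div_less_of_multiple[of a "2 * w" p q] m pq assms(2) by simp
    qed
  qed
  have "i = u" "j = e" using m by auto
  moreover have "{..<u} \<union> {u..<e} = {..<e}" using m by auto
  moreover have "A ` ({..<i} \<union> {u..<j}) = B ` {..<e}" using m by blast
  ultimately show "A ` {..<e} = B ` {..<e}" by metis
qed

text \<open>The new start \<open>e\<close> is \<open>2 * w * c\<close>, so the next two blocks of
  \<open>A\<close> have quotients \<open>2 * c\<close> and \<open>2 * c + 1\<close>. The minima cut
  them off at the end of the array.\<close>

lemma merging_next_block:
  assumes m: "merging N w A B a i u j e e" and A: "block_sorted w A N" and w: "0 < w" and e: "e < N"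
  shows "merging N w A B e e (min N (e + w)) (min N (e + w)) (min N (min N (e + w) + w)) e"
proof -
  have mod: "e mod (2 * w) = 0" using m e by (auto simp: merging_def)
  then obtain c where c: "e = 2 * w * c" by (metis mod_0_imp_dvd dvdE)
  have 1: "p div w = 2 * c" if "e \<le> p" "p < e + w" for p
    using that c w by (intro div_nat_eqI) (auto simp: algebra_simps)
  have 2: "p div w = 2 * c + 1" if "e + w \<le> p" "p < e + w + w" for p
    using that c w by (intro div_nat_eqI) (auto simp: algebra_simps)
  have s1: "sorted_between A e (min N (e + w))"
    using A 1 by (auto simp: sorted_between_def block_sorted_def)
  have s2: "sorted_between A (min N (e + w)) (min N (min N (e + w) + w))"
    unfolding sorted_between_def
  proof (intro allI impI)
    fix p q assume "min N (e + w) \<le> p" "p \<le> q" "q < min N (min N (e + w) + w)"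
    then have "e + w \<le> p" "p \<le> q" "q < e + w + w" "q < N" by auto
    then show "A p \<le> A q" using A 2[of p] 2[of q] by (auto simp: block_sorted_def)
  qed
  have e2: "min N (min N (e + w) + w) = N \<or> min N (min N (e + w) + w) mod (2 * w) = 0"
  proof (cases "e + w + w \<le> N")
    case True
    then have "min N (min N (e + w) + w) = e + 2 * w" by auto
    then show ?thesis using mod by (metis mod_add_self2)
  next
    case False
    then show ?thesis by auto
  qed
  have "{..<e} \<union> {min N (e + w)..<min N (e + w)} = {..<e}" by auto
  then show ?thesis
    unfolding merging_def using merging_block_done[OF m w] s1 s2 e2 mod e
    by (auto simp: sorted_between_def)
qed

text \<open>\<open>A i\<close> is below the rest of its own run by sortedness and below the other
  run by comparison with its head. What was written before is below everything not yet consumed, in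
  particular below \<open>A i\<close>.\<close>

lemma merging_left:
  assumes m: "merging N w A B a i u j e p" and i: "i < u" and le: "j < e \<Longrightarrow> A i \<le> A j"
  shows "merging N w A (B(p := A i)) a (Suc i) u j e (Suc p)"
proof -
  note m' = m[unfolded merging_def]
  have ap: "a \<le> p" and p: "p + u = i + j" using m' by auto
  have below: "A i \<le> A q" if "Suc i \<le> q \<and> q < u \<or> j \<le> q \<and> q < e" for q
  proof (cases "q < u")
    case True
    then show ?thesis using m' that i by (auto simp: sorted_between_def)
  next
    case False
    then have "j \<le> q" "q < e" using that by auto
    then have "A j \<le> A q" "A i \<le> A j" using m' le by (auto simp: sorted_between_def)
    then show ?thesis by simp
  qed
  have old: "B x \<le> A q" if "a \<le> x" "x < p" "i \<le> q \<and> q < u \<or> j \<le> q \<and> q < e" for x q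
    using m' that by blast
  have "sorted_between (B(p := A i)) a (Suc p)"
    using m' old[of _ i] i by (auto simp: sorted_between_def less_Suc_eq)
  moreover have "\<forall>x q. a \<le> x \<and> x < Suc p \<and> (Suc i \<le> q \<and> q < u \<or> j \<le> q \<and> q < e) \<longrightarrow>
      (B(p := A i)) x \<le> A q"
    using below old by (auto simp: less_Suc_eq)
  moreover have "block_sorted (2 * w) (B(p := A i)) a"
    using m' ap by (auto simp: block_sorted_def)
  moreover have "A ` ({..<Suc i} \<union> {u..<j}) = (B(p := A i)) ` {..<Suc p}"
  proof -
    have "A ` ({..<Suc i} \<union> {u..<j}) = insert (A i) (A ` ({..<i} \<union> {u..<j}))"
      by (auto simp: lessThan_Suc)
    also have "\<dots> = (B(p := A i)) ` {..<Suc p}" using m' by (auto simp: lessThan_Suc)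
    finally show ?thesis .
  qed
  ultimately show ?thesis using m' i unfolding merging_def by simp
qed

lemma merging_right:
  assumes m: "merging N w A B a i u j e p" and j: "j < e" and le: "i < u \<Longrightarrow> A j \<le> A i"
  shows "merging N w A (B(p := A j)) a i u (Suc j) e (Suc p)"
proof -
  note m' = m[unfolded merging_def]
  have ap: "a \<le> p" and p: "p + u = i + j" using m' by auto
  have below: "A j \<le> A q" if "i \<le> q \<and> q < u \<or> Suc j \<le> q \<and> q < e" for q
  proof (cases "q < u")
    case True
    then have "i \<le> q" using that m' by auto
    then have "A i \<le> A q" "A j \<le> A i" using m' True le by (auto simp: sorted_between_def)
    then show ?thesis by simp
  next
    case False
    then show ?thesis using m' that j by (auto simp: sorted_between_def)
  qed
  have old: "B x \<le> A q" if "a \<le> x" "x < p" "i \<le> q \<and> q < u \<or> j \<le> q \<and> q < e" for x q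
    using m' that by blast
  have "sorted_between (B(p := A j)) a (Suc p)"
    using m' old[of _ j] j by (auto simp: sorted_between_def less_Suc_eq)
  moreover have "\<forall>x q. a \<le> x \<and> x < Suc p \<and> (i \<le> q \<and> q < u \<or> Suc j \<le> q \<and> q < e) \<longrightarrow>
      (B(p := A j)) x \<le> A q"
    using below old by (auto simp: less_Suc_eq)
  moreover have "block_sorted (2 * w) (B(p := A j)) a"
    using m' ap by (auto simp: block_sorted_def)
  moreover have "A ` ({..<i} \<union> {u..<Suc j}) = (B(p := A j)) ` {..<Suc p}"
  proof -
    have "{u..<Suc j} = insert j {u..<j}" using m' by auto
    then have "A ` ({..<i} \<union> {u..<Suc j}) = insert (A j) (A ` ({..<i} \<union> {u..<j}))"
      by auto
    also have "\<dots> = (B(p := A j)) ` {..<Suc p}" using m' by (auto simp: lessThan_Suc)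
    finally show ?thesis .
  qed
  ultimately show ?thesis using m' j unfolding merging_def by simp
qed

definition next_block_com :: com where
  "next_block_com =
     NAssign ''i1'' (NVar ''o'') ;;
     NAssign ''u'' (NPlus (NVar ''o'') (NVar ''width'')) ;;
     Cond (NLess (NVar ''N'') (NVar ''u'')) (NAssign ''u'' (NVar ''N'')) Skip ;;
     NAssign ''j1'' (NVar ''u'') ;;
     NAssign ''e'' (NPlus (NVar ''u'') (NVar ''width'')) ;;
     Cond (NLess (NVar ''N'') (NVar ''e'')) (NAssign ''e'' (NVar ''N'')) Skip"

text \<open>Writes exactly one element and loads a new pair of blocks on demand. A whole pass
  thereby becomes a single counted loop, and its linear time is visible from the loop depth.\<close>

definition merge_step_com :: com where
  "merge_step_com =
     Cond (NLess (NVar ''o'') (NVar ''e'')) Skip next_block_com ;;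
     Cond (BAnd (NLess (NVar ''i1'') (NVar ''u''))
         (BNot (BAnd (NLess (NVar ''j1'') (NVar ''e''))
           (RLess (RArr ''A'' (NVar ''j1'')) (RArr ''A'' (NVar ''i1''))))))
       (RStore ''B'' (NVar ''o'') (RArr ''A'' (NVar ''i1'')) ;;
        NAssign ''i1'' (NPlus (NVar ''i1'') (NConst 1)))
       (RStore ''B'' (NVar ''o'') (RArr ''A'' (NVar ''j1'')) ;;
        NAssign ''j1'' (NPlus (NVar ''j1'') (NConst 1)))"

definition merge_pass_com :: com where
  "merge_pass_com =
     NAssign ''i1'' (NConst 0) ;; NAssign ''u'' (NConst 0) ;;
     NAssign ''j1'' (NConst 0) ;; NAssign ''e'' (NConst 0) ;;
     For ''o'' ''N'' merge_step_com ;;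
     For ''o'' ''N'' (RStore ''A'' (NVar ''o'') (RArr ''B'' (NVar ''o'')))"

definition sort_com :: com where
  "sort_com = NAssign ''width'' (NConst 1) ;;
     Loop (NLess (NVar ''width'') (NVar ''N''))
       (merge_pass_com ;; NAssign ''width'' (NPlus (NVar ''width'') (NVar ''width'')))"

text \<open>The start \<open>a\<close> of the current pair is a ghost quantity that the program
  never stores.\<close>

definition merging_store :: "nat \<Rightarrow> nat \<Rightarrow> (nat \<Rightarrow> real) \<Rightarrow> nat \<Rightarrow> store \<Rightarrow> bool" where
  "merging_store N w A p s \<longleftrightarrow>
     (\<exists>a. merging N w A (rarr s ''B'') a (nvar s ''i1'') (nvar s ''u'') (nvar s ''j1'') (nvar s ''e'') p)"

lemma merge_step_correct:
  assumes "merging_store N w A p s" "block_sorted w A N" "0 < w" "p < N"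
    and s: "nvar s ''o'' = p" "nvar s ''N'' = N" "nvar s ''width'' = w" "rarr s ''A'' = A"
  shows "bounded_run m merge_step_com s (\<lambda>s'. merging_store N w A (Suc p) (set_nvar ''o'' (Suc p) s'))"
proof -
  have block: "bounded_run m (Cond (NLess (NVar ''o'') (NVar ''e'')) Skip next_block_com) s
    (\<lambda>s'. merging_store N w A p s' \<and> p < nvar s' ''e'' \<and> nvar s' ''o'' = p \<and> rarr s' ''A'' = A)"
  proof (rule bounded_run_loop_free)
    show "loop_free (Cond (NLess (NVar ''o'') (NVar ''e'')) Skip next_block_com)"
      by (simp add: next_block_com_def)
    from assms(1) obtain a where
      a: "merging N w A (rarr s ''B'') a (nvar s ''i1'') (nvar s ''u'') (nvar s ''j1'') (nvar s ''e'') p"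
      by (auto simp: merging_store_def)
    have min: "(if N < x then N else x) = min N x" for x :: nat by auto
    have new: "merging_store N w A p (result next_block_com s) \<and> p < nvar (result next_block_com s) ''e''"
      if "\<not> p < nvar s ''e''"
    proof -
      \<comment> \<open>The balance \<open>p + u = i + j\<close> gives \<open>p \<le> e\<close>, so
        the pair is exactly used up.\<close>
      have "nvar s ''e'' = p" using a that by (auto simp: merging_def)
      then have "merging N w A (rarr s ''B'') p p (min N (p + w)) (min N (p + w))
          (min N (min N (p + w) + w)) p"
        using merging_next_block[of N w A "rarr s ''B''"] a assms by metis
      \<comment> \<open>Since \<open>p < N\<close> and \<open>0 < w\<close>, a fresh pair is
        nonempty, and one load per step suffices.\<close>
      moreover have "p < min N (min N (p + w) + w)" using assms by simp
      ultimately show ?thesis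
        unfolding merging_store_def next_block_com_def using s by (auto simp: min)
    qed
    have "nvar (result next_block_com s) ''o'' = p" "rarr (result next_block_com s) ''A'' = A"
      using s by (simp_all add: next_block_com_def)
    then show "merging_store N w A p (result (Cond (NLess (NVar ''o'') (NVar ''e'')) Skip next_block_com) s) \<and>
      p < nvar (result (Cond (NLess (NVar ''o'') (NVar ''e'')) Skip next_block_com) s) ''e'' \<and>
      nvar (result (Cond (NLess (NVar ''o'') (NVar ''e'')) Skip next_block_com) s) ''o'' = p \<and>
      rarr (result (Cond (NLess (NVar ''o'') (NVar ''e'')) Skip next_block_com) s) ''A'' = A"
      using new assms(1) s by auto
  qed
  show ?thesis unfolding merge_step_com_def
  proof (rule bounded_run_Seq, rule bounded_run_mono[OF block], elim conjE)
    fix s' assume m: "merging_store N w A p s'" and s': "p < nvar s' ''e''" "nvar s' ''o'' = p" "rarr s' ''A'' = A"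
    from m obtain a where
      a: "merging N w A (rarr s' ''B'') a (nvar s' ''i1'') (nvar s' ''u'') (nvar s' ''j1'') (nvar s' ''e'') p"
      by (auto simp: merging_store_def)
    \<comment> \<open>With the left run exhausted, the balance gives \<open>p = j\<close>, and
      \<open>p < e\<close> leaves the right run nonempty.\<close>
    have j: "nvar s' ''j1'' < nvar s' ''e''" if "\<not> nvar s' ''i1'' < nvar s' ''u''"
      using a that s' by (auto simp: merging_def)
    show "bounded_run m
        (Cond (BAnd (NLess (NVar ''i1'') (NVar ''u''))
         (BNot (BAnd (NLess (NVar ''j1'') (NVar ''e''))
           (RLess (RArr ''A'' (NVar ''j1'')) (RArr ''A'' (NVar ''i1''))))))
       (RStore ''B'' (NVar ''o'') (RArr ''A'' (NVar ''i1'')) ;;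
        NAssign ''i1'' (NPlus (NVar ''i1'') (NConst 1)))
       (RStore ''B'' (NVar ''o'') (RArr ''A'' (NVar ''j1'')) ;;
        NAssign ''j1'' (NPlus (NVar ''j1'') (NConst 1)))) s'
       (\<lambda>s'. merging_store N w A (Suc p) (set_nvar ''o'' (Suc p) s'))"
      (is "bounded_run m (Cond ?p ?l ?r) s' ?Q")
    proof (rule bounded_run_Cond)
      assume "bval ?p s'"
      then have "merging_store N w A (Suc p) (set_nvar ''o'' (Suc p) (result ?l s'))"
        using merging_left[OF a] s' by (simp add: merging_store_def) (metis not_less)
      then show "bounded_run m ?l s' ?Q" by (intro bounded_run_loop_free) simp_all
    next
      assume "\<not> bval ?p s'"
      then have "merging_store N w A (Suc p) (set_nvar ''o'' (Suc p) (result ?r s'))"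
        using merging_right[OF a] s' j by (simp add: merging_store_def) (metis less_imp_le)
      then show "bounded_run m ?r s' ?Q" by (intro bounded_run_loop_free) simp_all
    qed
  qed
qed

lemma merge_pass_correct:
  assumes N: "nvar s ''N'' = N" and w: "nvar s ''width'' = w" "0 < w"
    and A: "rarr s ''A'' = A" "block_sorted w A N"
  shows "bounded_run N merge_pass_com s
    (\<lambda>s'. block_sorted (2 * w) (rarr s' ''A'') N \<and> rarr s' ''A'' ` {..<N} = A ` {..<N})"
proof -
  let ?s = "set_nvar ''e'' 0 (set_nvar ''j1'' 0 (set_nvar ''u'' 0 (set_nvar ''i1'' 0 s)))"
  let ?Q = "\<lambda>s'. block_sorted (2 * w) (rarr s' ''A'') N \<and> rarr s' ''A'' ` {..<N} = A ` {..<N}"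
  have 1: "bounded_run N (For ''o'' ''N'' merge_step_com) ?s
    (\<lambda>s'. block_sorted (2 * w) (rarr s' ''B'') N \<and> rarr s' ''B'' ` {..<N} = A ` {..<N} \<and> nvar s' ''N'' = N)"
  proof (rule bounded_run_For[where N = N and I = "merging_store N w A"])
    show "merging_store N w A 0 (set_nvar ''o'' 0 ?s)"
      unfolding merging_store_def using merging_init by (intro exI[of _ 0]) simp
  next
    fix p s' assume p: "p < N" "merging_store N w A p s'" "nvar s' ''o'' = p"
      and ag: "agree (For ''o'' ''N'' merge_step_com) ?s s'"
    show "bounded_run N merge_step_com s' (\<lambda>s''. merging_store N w A (Suc p) (set_nvar ''o'' (Suc p) s''))"
      using p w A N by (intro merge_step_correct)
        (simp_all add: agreeD[OF ag] merge_step_com_def next_block_com_def)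
  next
    fix s' assume m: "merging_store N w A N s'" and ag: "agree (For ''o'' ''N'' merge_step_com) ?s s'"
    from m obtain a where
      a: "merging N w A (rarr s' ''B'') a (nvar s' ''i1'') (nvar s' ''u'') (nvar s' ''j1'') (nvar s' ''e'') N"
      by (auto simp: merging_store_def)
    then have "nvar s' ''e'' = N" by (auto simp: merging_def)
    then show "block_sorted (2 * w) (rarr s' ''B'') N \<and> rarr s' ''B'' ` {..<N} = A ` {..<N} \<and> nvar s' ''N'' = N"
      using merging_block_done a w N agreeD(1)[OF ag, of "''N''"]
      by (simp add: merge_step_com_def next_block_com_def)
  qed (use N in \<open>simp_all add: merge_step_com_def next_block_com_def\<close>)
  have 2: "bounded_run N (For ''o'' ''N'' (RStore ''A'' (NVar ''o'') (RArr ''B'' (NVar ''o'')))) s' ?Q"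
    if "block_sorted (2 * w) (rarr s' ''B'') N" "rarr s' ''B'' ` {..<N} = A ` {..<N}" "nvar s' ''N'' = N" for s'
  proof (rule bounded_run_For[where N = N and I = "\<lambda>j s'. \<forall>i<j. rarr s' ''A'' i = rarr s' ''B'' i"])
    fix s'' assume eq: "\<forall>i<N. rarr s'' ''A'' i = rarr s'' ''B'' i"
      and ag: "agree (For ''o'' ''N'' (RStore ''A'' (NVar ''o'') (RArr ''B'' (NVar ''o'')))) s' s''"
    have B: "rarr s'' ''B'' = rarr s' ''B''" by (simp add: agreeD[OF ag])
    have "rarr s'' ''A'' ` {..<N} = rarr s' ''B'' ` {..<N}" using eq B by (intro image_cong) auto
    moreover have "block_sorted (2 * w) (rarr s'' ''A'') N"
      using that(1) eq B by (simp add: block_sorted_def)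
    ultimately show "?Q s''" using that by simp
  next
    fix j and s'' :: store assume "\<forall>i<j. rarr s'' ''A'' i = rarr s'' ''B'' i" "nvar s'' ''o'' = j"
    then show "bounded_run N (RStore ''A'' (NVar ''o'') (RArr ''B'' (NVar ''o''))) s''
      (\<lambda>s''. \<forall>i<Suc j. rarr (set_nvar ''o'' (Suc j) s'') ''A'' i = rarr (set_nvar ''o'' (Suc j) s'') ''B'' i)"
      by (intro bounded_run_loop_free) (auto simp: less_Suc_eq)
  qed (use that in simp_all)
  have 3: "bounded_run N (For ''o'' ''N'' merge_step_com) ?s
    (\<lambda>s'. bounded_run N (For ''o'' ''N'' (RStore ''A'' (NVar ''o'') (RArr ''B'' (NVar ''o'')))) s' ?Q)"
    by (rule bounded_run_mono[OF 1]) (use 2 in blast)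
  show ?thesis unfolding merge_pass_com_def
    by (rule bounded_run_Seq, rule bounded_run_loop_free, simp)+
      (use bounded_run_Seq[OF 3] in simp)
qed

text \<open>Tracking the set of values without multiplicities suffices, since the search only needs
  the optimal distance to occur in the sorted array. Each pass adds 8 units for the loop test and
  the doubling; the last test and the initial assignment make 6.\<close>

lemma sort_correct:
  assumes N: "nvar s ''N'' = N" "N \<le> 2 ^ m"
  shows "runs sort_com s (m * (time_bound N merge_pass_com + 8) + 6)
    (\<lambda>s'. sorted_between (rarr s' ''A'') 0 N \<and> rarr s' ''A'' ` {..<N} = rarr s ''A'' ` {..<N})"
proof -
  let ?A = "rarr s ''A''" and ?s = "set_nvar ''width'' 1 s"
  let ?p = "NLess (NVar ''width'') (NVar ''N'')"
  let ?d = "NAssign ''width'' (NPlus (NVar ''width'') (NVar ''width''))"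
  \<comment> \<open>\<open>q\<close> bounds the doublings still needed; for \<open>q = 0\<close> the
    width has reached \<open>N\<close> and the guard fails.\<close>
  define I where "I q s' \<longleftrightarrow> 0 < nvar s' ''width'' \<and> N \<le> nvar s' ''width'' * 2 ^ q \<and>
    block_sorted (nvar s' ''width'') (rarr s' ''A'') N \<and> rarr s' ''A'' ` {..<N} = ?A ` {..<N}" for q and s' :: store
  have "runs (Loop ?p (merge_pass_com ;; ?d)) ?s
      (m * (bcost ?p + 1 + (time_bound N merge_pass_com + 4)) + (bcost ?p + 1))
      (\<lambda>s'. (\<exists>q. I q s') \<and> \<not> bval ?p s')"
  proof (rule runs_Loop)
    show "I m ?s" using N by (auto simp: I_def block_sorted_def)
    fix q s' assume I: "I q s'" and p: "bval ?p s'" and ag: "agree (merge_pass_com ;; ?d) ?s s'"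
    have N': "nvar s' ''N'' = N"
      using N by (simp add: agreeD[OF ag] merge_pass_com_def merge_step_com_def next_block_com_def)
    obtain q' where q': "q = Suc q'" using I p N' by (cases q) (auto simp: I_def)
    have "runs merge_pass_com s' (time_bound N merge_pass_com)
        (\<lambda>s''. runs ?d s'' 4 (I q'))"
    proof (rule runs_mono[OF _ order_refl])
      show "runs merge_pass_com s' (time_bound N merge_pass_com)
        (\<lambda>s''. block_sorted (2 * nvar s' ''width'') (rarr s'' ''A'') N \<and>
          rarr s'' ''A'' ` {..<N} = rarr s' ''A'' ` {..<N})"
        using merge_pass_correct[OF N' refl _ refl] I by (simp add: I_def bounded_run_def)
      fix s'' assume ag': "agree merge_pass_com s' s''"
        and *: "block_sorted (2 * nvar s' ''width'') (rarr s'' ''A'') N \<and>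
          rarr s'' ''A'' ` {..<N} = rarr s' ''A'' ` {..<N}"
      have "nvar s'' ''width'' = nvar s' ''width''"
        by (simp add: agreeD[OF ag'] merge_pass_com_def merge_step_com_def next_block_com_def)
      then have "I q' (result ?d s'')" using * I q' by (auto simp: I_def mult_2[symmetric] mult.assoc)
      then have "bounded_run N ?d s'' (I q')" by (intro bounded_run_loop_free) simp_all
      then show "runs ?d s'' 4 (I q')" by (simp add: bounded_run_def numeral_eq_Suc)
    qed
    from runs_Seq[OF this] show "\<exists>q'. q = Suc q' \<and>
        runs (merge_pass_com ;; ?d) s' (time_bound N merge_pass_com + 4) (I q')"
      using q' by blast
  qed
  then have "runs (Loop ?p (merge_pass_com ;; ?d)) ?s (m * (time_bound N merge_pass_com + 8) + 4)
    (\<lambda>s'. sorted_between (rarr s' ''A'') 0 N \<and> rarr s' ''A'' ` {..<N} = ?A ` {..<N})"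
  proof (rule runs_mono)
    fix s' assume ag: "agree (Loop ?p (merge_pass_com ;; ?d)) ?s s'"
      and *: "(\<exists>q. I q s') \<and> \<not> bval ?p s'"
    have "nvar s' ''N'' = N"
      using N by (simp add: agreeD[OF ag] merge_pass_com_def merge_step_com_def next_block_com_def)
    then show "sorted_between (rarr s' ''A'') 0 N \<and> rarr s' ''A'' ` {..<N} = ?A ` {..<N}"
      using * by (auto simp: I_def block_sorted_def sorted_between_def)
  qed (simp add: algebra_simps)
  moreover have "runs (NAssign ''width'' (NConst 1)) s 2 (\<lambda>s'. s' = ?s)"
    using loop_free_runs[of "NAssign ''width'' (NConst 1)" s N] by (simp add: numeral_eq_Suc)
  ultimately have "runs (NAssign ''width'' (NConst 1)) s 2
      (\<lambda>s'. runs (Loop ?p (merge_pass_com ;; ?d)) s' (m * (time_bound N merge_pass_com + 8) + 4)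
    (\<lambda>s'. sorted_between (rarr s' ''A'') 0 N \<and> rarr s' ''A'' ` {..<N} = ?A ` {..<N}))"
    by (auto intro: runs_mono)
  from runs_Seq[OF this] show ?thesis unfolding sort_com_def by (simp add: add.commute)
qed

section \<open>The decision procedure for a guessed radius\<close>

text \<open>Expressions cannot multiply, so \<open>row\<close> tabulates the multiples of
  \<open>n\<close>; a matrix entry then costs constant time.\<close>

abbreviation dist_exp :: "vname \<Rightarrow> nexp \<Rightarrow> rexp" where
  "dist_exp i e \<equiv> RArr ''d'' (NPlus (NArr ''row'' (NVar i)) e)"

definition reset_com :: com where
  "reset_com = For ''i'' ''n''
     (NStore ''cov'' (NVar ''i'') (NConst 0) ;;
      NStore ''C0'' (NVar ''i'') (NConst 0) ;;
      NStore ''w'' (NVar ''i'') (NConst 0))"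

definition cover_com :: com where
  "cover_com = For ''j'' ''n''
     (Cond (BAnd (NLess (NArr ''cov'' (NVar ''j'')) (NConst 1))
         (BNot (RLess (RPlus (RVar ''r'') (RVar ''r'')) (dist_exp ''i'' (NVar ''j'')))))
       (NStore ''cov'' (NVar ''j'') (NPlus (NVar ''i'') (NConst 1))) Skip)"

definition reps_com :: com where
  "reps_com = NAssign ''m'' (NConst 0) ;; For ''i'' ''n''
     (Cond (NLess (NArr ''cov'' (NVar ''i'')) (NConst 1))
       (NAssign ''m'' (NPlus (NVar ''m'') (NConst 1)) ;; cover_com) Skip)"

definition weights_com :: com where
  "weights_com = For ''i'' ''n''
     (Cond (BNot (RLess (RVar ''r'') (dist_exp ''i'' (NArr ''lH'' (NVar ''i'')))))
       (NStore ''w'' (NArr ''lH'' (NVar ''i'')) (NPlus (NArr ''w'' (NArr ''lH'' (NVar ''i''))) (NConst 1)))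
       Skip)"

text \<open>Weights are shifted by one, so that \<open>bw = 0\<close> signals that no candidate has been found.\<close>

definition heaviest_com :: "bexp \<Rightarrow> com" where
  "heaviest_com p = NAssign ''bw'' (NConst 0) ;; For ''j'' ''n''
     (Cond (BAnd p (NLess (NVar ''bw'') (NPlus (NArr ''w'' (NVar ''j'')) (NConst 1))))
       (NAssign ''bw'' (NPlus (NArr ''w'' (NVar ''j'')) (NConst 1)) ;; NAssign ''best'' (NVar ''j'')) Skip)"

text \<open>Two strict comparisons express \<open>cov i = i + 1\<close>, the mark of a
  representative, as tests have no equality. Presetting \<open>best\<close> to \<open>i\<close>
  provides the fallback when no historical center is near.\<close>

definition centers_com :: com where
  "centers_com = For ''i'' ''n''
     (Cond (BAnd (NLess (NVar ''i'') (NArr ''cov'' (NVar ''i'')))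
         (NLess (NArr ''cov'' (NVar ''i'')) (NPlus (NVar ''i'') (NConst 2))))
       (NAssign ''best'' (NVar ''i'') ;;
        heaviest_com (BAnd (NLess (NConst 0) (NArr ''H'' (NVar ''j'')))
          (BNot (RLess (RVar ''r'') (dist_exp ''i'' (NVar ''j''))))) ;;
        (NStore ''cen'' (NVar ''i'') (NVar ''best'') ;;
         NStore ''C0'' (NVar ''best'') (NConst 1)))
       Skip)"

text \<open>For \<open>k < m\<close> the truncated difference is 0 and nothing is added;
  \<open>accept_com\<close> rejects such a guess afterwards.\<close>

definition extra_com :: com where
  "extra_com = NAssign ''ex'' (NMinus (NVar ''k'') (NVar ''m'')) ;; For ''q'' ''ex''
     (NAssign ''best'' (NConst 0) ;;
      heaviest_com (BAnd (NLess (NConst 0) (NArr ''H'' (NVar ''j'')))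
        (BNot (NLess (NConst 0) (NArr ''C0'' (NVar ''j''))))) ;;
      NStore ''C0'' (NVar ''best'') (NConst 1))"

text \<open>A label is kept only within \<open>r\<close>, although \<open>3 * r\<close> would be
  affordable: this is the test in \<open>weight\<close>, so the kept points number exactly the
  weight of the chosen historical centers. \<open>cnt\<close> may exceed the number of changed
  labels, since a reassigned point can land on its old label.\<close>

definition label_com :: com where
  "label_com = NAssign ''cnt'' (NConst 0) ;; For ''i'' ''n''
     (Cond (BAnd (NLess (NConst 0) (NArr ''C0'' (NArr ''lH'' (NVar ''i''))))
         (BNot (RLess (RVar ''r'') (dist_exp ''i'' (NArr ''lH'' (NVar ''i''))))))
       (NStore ''l0'' (NVar ''i'') (NArr ''lH'' (NVar ''i'')))
       (NStore ''l0'' (NVar ''i'') (NArr ''cen'' (NMinus (NArr ''cov'' (NVar ''i'')) (NConst 1))) ;;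
        NAssign ''cnt'' (NPlus (NVar ''cnt'') (NConst 1))))"

definition accept_com :: com where
  "accept_com = Cond (BAnd (BNot (NLess (NVar ''k'') (NVar ''m''))) (BNot (NLess (NVar ''b'') (NVar ''cnt''))))
     (NAssign ''ok'' (NConst 1)) (NAssign ''ok'' (NConst 0))"

definition check_com :: com where
  "check_com = reset_com ;; reps_com ;; weights_com ;; centers_com ;; extra_com ;; label_com ;; accept_com"

lemma written_cover [simp]:
  "written_nvar cover_com = {''j''}" "written_narr cover_com = {''cov''}"
  "written_rvar cover_com = {}" "written_rarr cover_com = {}"
  by (auto simp: cover_com_def)

lemma written_heaviest [simp]:
  "written_nvar (heaviest_com p) = {''bw'', ''j'', ''best''}" "written_narr (heaviest_com p) = {}"
  "written_rvar (heaviest_com p) = {}" "written_rarr (heaviest_com p) = {}"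
  by (auto simp: heaviest_com_def)

lemma written_reset [simp]:
  "written_nvar reset_com = {''i''}" "written_narr reset_com = {''cov'', ''C0'', ''w''}"
  "written_rvar reset_com = {}" "written_rarr reset_com = {}"
  by (auto simp: reset_com_def)

lemma written_reps [simp]:
  "written_nvar reps_com = {''i'', ''j'', ''m''}" "written_narr reps_com = {''cov''}"
  "written_rvar reps_com = {}" "written_rarr reps_com = {}"
  by (auto simp: reps_com_def)

lemma written_weights [simp]:
  "written_nvar weights_com = {''i''}" "written_narr weights_com = {''w''}"
  "written_rvar weights_com = {}" "written_rarr weights_com = {}"
  by (auto simp: weights_com_def)

lemma written_centers [simp]:
  "written_nvar centers_com = {''i'', ''bw'', ''j'', ''best''}" "written_narr centers_com = {''cen'', ''C0''}"
  "written_rvar centers_com = {}" "written_rarr centers_com = {}"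
  by (auto simp: centers_com_def)

lemma written_extra [simp]:
  "written_nvar extra_com = {''ex'', ''q'', ''bw'', ''j'', ''best''}" "written_narr extra_com = {''C0''}"
  "written_rvar extra_com = {}" "written_rarr extra_com = {}"
  by (auto simp: extra_com_def)

lemma written_label [simp]:
  "written_nvar label_com = {''i'', ''cnt''}" "written_narr label_com = {''l0''}"
  "written_rvar label_com = {}" "written_rarr label_com = {}"
  by (auto simp: label_com_def)

lemma written_accept [simp]:
  "written_nvar accept_com = {''ok''}" "written_narr accept_com = {}"
  "written_rvar accept_com = {}" "written_rarr accept_com = {}"
  by (auto simp: accept_com_def)

text \<open>The hypothesis on \<open>p\<close> says that, during the scan, the test depends on the
  state only through \<open>j\<close>. Without candidates \<open>best\<close> is untouched, so the
  caller chooses the default.\<close>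

lemma heaviest_correct:
  assumes n: "nvar s ''n'' = n"
    and p: "\<And>s'. agree (heaviest_com p) s s' \<Longrightarrow> nvar s' ''j'' < n \<Longrightarrow> bval p s' \<longleftrightarrow> P (nvar s' ''j'')"
  shows "bounded_run n (heaviest_com p) s (\<lambda>s'.
    (\<forall>j<n. \<not> P j) \<and> nvar s' ''best'' = nvar s ''best'' \<or>
    nvar s' ''best'' < n \<and> P (nvar s' ''best'') \<and>
      (\<forall>j<n. P j \<longrightarrow> narr s ''w'' j \<le> narr s ''w'' (nvar s' ''best'')))"
    (is "bounded_run n _ s ?Q")
proof -
  let ?c = "Cond (BAnd p (NLess (NVar ''bw'') (NPlus (NArr ''w'' (NVar ''j'')) (NConst 1))))
       (NAssign ''bw'' (NPlus (NArr ''w'' (NVar ''j'')) (NConst 1)) ;; NAssign ''best'' (NVar ''j'')) Skip"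
  let ?w = "narr s ''w''" and ?s = "set_nvar ''bw'' 0 s"
  define I where "I j s' \<longleftrightarrow>
    (\<forall>i<j. \<not> P i) \<and> nvar s' ''best'' = nvar s ''best'' \<and> nvar s' ''bw'' = 0 \<or>
    nvar s' ''best'' < j \<and> P (nvar s' ''best'') \<and> nvar s' ''bw'' = ?w (nvar s' ''best'') + 1 \<and>
      (\<forall>i<j. P i \<longrightarrow> ?w i \<le> ?w (nvar s' ''best''))" for j and s' :: store
  have "bounded_run n (For ''j'' ''n'' ?c) ?s ?Q"
  proof (rule bounded_run_For[where N = n and I = I])
    show "I 0 (set_nvar ''j'' 0 ?s)" by (simp add: I_def)
  next
    fix j s' assume j: "j < n" and I: "I j s'" and s': "nvar s' ''j'' = j"
      and ag: "agree (For ''j'' ''n'' ?c) ?s s'"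
    have "agree (heaviest_com p) s s'" using ag by (auto simp: agree_def heaviest_com_def)
    then have pj: "bval p s' \<longleftrightarrow> P j" using p s' j by blast
    have w: "narr s' ''w'' = ?w" by (simp add: agreeD[OF ag])
    have "I (Suc j) (set_nvar ''j'' (Suc j) (result ?c s'))"
      using I pj s' w by (auto simp: I_def less_Suc_eq)
    then show "bounded_run n ?c s' (\<lambda>s''. I (Suc j) (set_nvar ''j'' (Suc j) s''))"
      by (intro bounded_run_loop_free) simp_all
  next
    fix s' assume "I n s'"
    then show "?Q s'" by (auto simp: I_def)
  qed (use n in simp_all)
  then show ?thesis unfolding heaviest_com_def
    by (intro bounded_run_Seq bounded_run_loop_free[of "NAssign _ _"]) simp_all
qed

section \<open>Correctness of the phases for one guess\<close>

context indexed_instance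
begin

definition inputs :: "store \<Rightarrow> bool" where
  "inputs s \<longleftrightarrow> nvar s ''n'' = n \<and> nvar s ''k'' = k \<and> nvar s ''b'' = b \<and>
     (\<forall>i<n. 0 < narr s ''H'' i \<longleftrightarrow> i \<in> H) \<and> (\<forall>i<n. narr s ''lH'' i = lH i) \<and>
     (\<forall>i<n. \<forall>j<n. rarr s ''d'' (narr s ''row'' i + j) = D i j)"

lemma inputs_agree:
  assumes "inputs s" "agree c s s'"
    and "''n'' \<notin> written_nvar c" "''k'' \<notin> written_nvar c" "''b'' \<notin> written_nvar c"
    and "''H'' \<notin> written_narr c" "''lH'' \<notin> written_narr c" "''row'' \<notin> written_narr c"
    and "''d'' \<notin> written_rarr c"
  shows "inputs s'"
  using assms(1) unfolding inputs_def by (simp add: agreeD[OF assms(2)] assms)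

lemma inputs_set_nvar:
  "inputs s \<Longrightarrow> x \<notin> {''n'', ''k'', ''b''} \<Longrightarrow> inputs (set_nvar x v s)"
  by (auto simp: inputs_def)

lemma lH_less: "i < n \<Longrightarrow> lH i < n"
  using lH H_sub by blast

lemma reset_correct:
  assumes "inputs s"
  shows "bounded_run n reset_com s
    (\<lambda>s'. \<forall>i<n. narr s' ''cov'' i = 0 \<and> narr s' ''C0'' i = 0 \<and> narr s' ''w'' i = 0)"
  unfolding reset_com_def
proof (rule bounded_run_For[where N = n and
      I = "\<lambda>j s'. \<forall>i<j. narr s' ''cov'' i = 0 \<and> narr s' ''C0'' i = 0 \<and> narr s' ''w'' i = 0"])
  fix j and s' :: store
  assume "\<forall>i<j. narr s' ''cov'' i = 0 \<and> narr s' ''C0'' i = 0 \<and> narr s' ''w'' i = 0" "nvar s' ''i'' = j"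
  then show "bounded_run n (NStore ''cov'' (NVar ''i'') (NConst 0) ;;
      NStore ''C0'' (NVar ''i'') (NConst 0) ;; NStore ''w'' (NVar ''i'') (NConst 0)) s'
    (\<lambda>s''. \<forall>i<Suc j. narr (set_nvar ''i'' (Suc j) s'') ''cov'' i = 0 \<and>
      narr (set_nvar ''i'' (Suc j) s'') ''C0'' i = 0 \<and> narr (set_nvar ''i'' (Suc j) s'') ''w'' i = 0)"
    by (intro bounded_run_loop_free) (auto simp: less_Suc_eq)
qed (use assms in \<open>auto simp: inputs_def\<close>)

lemma cover_correct:
  assumes s: "inputs s" "rvar s ''r'' = r" "nvar s ''i'' = i" "i < n"
  shows "bounded_run n cover_com s (\<lambda>s'. narr s' ''cov'' =
    (\<lambda>x. if x < n \<and> narr s ''cov'' x = 0 \<and> D i x \<le> 2 * r then i + 1 else narr s ''cov'' x))"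
proof -
  let ?cov = "narr s ''cov''"
  let ?c = "Cond (BAnd (NLess (NArr ''cov'' (NVar ''j'')) (NConst 1))
         (BNot (RLess (RPlus (RVar ''r'') (RVar ''r'')) (dist_exp ''i'' (NVar ''j'')))))
       (NStore ''cov'' (NVar ''j'') (NPlus (NVar ''i'') (NConst 1))) Skip"
  define I where "I j s' \<longleftrightarrow> narr s' ''cov'' =
    (\<lambda>x. if x < j \<and> ?cov x = 0 \<and> D i x \<le> 2 * r then i + 1 else ?cov x)" for j and s' :: store
  show ?thesis unfolding cover_com_def
  proof (rule bounded_run_For[where N = n and I = I])
    show "I 0 (set_nvar ''j'' 0 s)" by (simp add: I_def)
  next
    fix j s' assume j: "j < n" and I: "I j s'" and s': "nvar s' ''j'' = j"
      and ag: "agree (For ''j'' ''n'' ?c) s s'"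
    have "inputs s'" by (rule inputs_agree[OF s(1) ag]) simp_all
    then have d: "rarr s' ''d'' (narr s' ''row'' i + j) = D i j" using s j by (simp add: inputs_def)
    have r: "rvar s' ''r'' = r" "nvar s' ''i'' = i" using s by (simp_all add: agreeD[OF ag])
    have "I (Suc j) (set_nvar ''j'' (Suc j) (result ?c s'))"
      using I s' r d by (auto simp: I_def less_Suc_eq fun_eq_iff)
    then show "bounded_run n ?c s' (\<lambda>s''. I (Suc j) (set_nvar ''j'' (Suc j) s''))"
      by (intro bounded_run_loop_free) simp_all
  qed (use s in \<open>simp_all add: I_def inputs_def\<close>)
qed

definition reps :: "(nat \<Rightarrow> nat) \<Rightarrow> nat \<Rightarrow> nat set" where
  "reps cov i = {s. s < i \<and> cov s = s + 1}"

text \<open>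
  \<open>cov x\<close> is the successor of the representative covering \<open>x\<close>, or zero if there is none.
\<close>

definition covering :: "real \<Rightarrow> (nat \<Rightarrow> nat) \<Rightarrow> nat \<Rightarrow> bool" where
  "covering r cov i \<longleftrightarrow>
     (\<forall>x<n. cov x = 0 \<longrightarrow> (\<forall>s\<in>reps cov i. 2 * r < D s x)) \<and>
     (\<forall>x<n. cov x \<noteq> 0 \<longrightarrow> cov x - 1 \<in> reps cov i \<and> D (cov x - 1) x \<le> 2 * r) \<and>
     (\<forall>x<i. cov x \<noteq> 0) \<and> separated r (reps cov i)"

lemma covering_skip:
  assumes "covering r cov i" "cov i \<noteq> 0" "i < n"
  shows "reps cov (Suc i) = reps cov i" "covering r cov (Suc i)"
proof -
  have "cov i - 1 < i" using assms by (auto simp: covering_def reps_def)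
  then have "cov i \<noteq> i + 1" by linarith
  then show "reps cov (Suc i) = reps cov i" by (auto simp: reps_def less_Suc_eq)
  then show "covering r cov (Suc i)" using assms by (auto simp: covering_def less_Suc_eq)
qed

text \<open>An uncovered \<open>i\<close> is more than \<open>2 * r\<close> from all earlier
  representatives, so separation survives. Only uncovered points are relabeled, so earlier
  representatives keep their marks.\<close>

lemma covering_extend:
  assumes c: "covering r cov i" "cov i = 0" "i < n" and r: "0 \<le> r"
    and cov': "cov' = (\<lambda>x. if x < n \<and> cov x = 0 \<and> D i x \<le> 2 * r then i + 1 else cov x)"
  shows "reps cov' (Suc i) = insert i (reps cov i)" "covering r cov' (Suc i)"
proof -
  have nz: "cov x \<noteq> 0" if "x < i" for x using c that by (simp add: covering_def)
  \<comment> \<open>The new representative covers itself because \<open>D i i = 0\<close> and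
    \<open>0 \<le> r\<close>; \<open>reps\<close> recognises it by this.\<close>
  have ii: "cov' i = i + 1" using c r D_refl by (simp add: cov')
  have old: "cov' x = cov x" if "cov x \<noteq> 0" for x using that by (simp add: cov')
  show R: "reps cov' (Suc i) = insert i (reps cov i)"
  proof -
    have "cov' x = cov x" if "x < i" for x using old nz that by blast
    then show ?thesis using ii by (auto simp: reps_def less_Suc_eq)
  qed
  have Rn: "s < n" if "s \<in> reps cov i" for s using that c by (simp add: reps_def)
  have far: "2 * r < D s i" if "s \<in> reps cov i" for s using c that by (simp add: covering_def)
  have far': "2 * r < D i s" if "s \<in> reps cov i" for s using far[OF that] D_sym by metis
  have "separated r (insert i (reps cov i))"
    using c Rn far far' unfolding separated_def covering_def by auto
  moreover have "\<forall>x<n. cov' x = 0 \<longrightarrow> (\<forall>s\<in>insert i (reps cov i). 2 * r < D s x)"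
    using c by (auto simp: cov' covering_def)
  moreover have "\<forall>x<n. cov' x \<noteq> 0 \<longrightarrow> cov' x - 1 \<in> insert i (reps cov i) \<and> D (cov' x - 1) x \<le> 2 * r"
    using c by (auto simp: cov' covering_def)
  moreover have "\<forall>x<Suc i. cov' x \<noteq> 0" using ii old nz by (auto simp: less_Suc_eq)
  ultimately show "covering r cov' (Suc i)" unfolding covering_def R by blast
qed

lemma reps_correct:
  assumes s: "inputs s" "rvar s ''r'' = r" "0 \<le> r" "\<And>i. i < n \<Longrightarrow> narr s ''cov'' i = 0"
  shows "bounded_run n reps_com s (\<lambda>s'. covering r (narr s' ''cov'') n \<and>
    nvar s' ''m'' = card (reps (narr s' ''cov'') n))"
proof -
  let ?c = "Cond (NLess (NArr ''cov'' (NVar ''i'')) (NConst 1))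
       (NAssign ''m'' (NPlus (NVar ''m'') (NConst 1)) ;; cover_com) Skip"
  let ?s = "set_nvar ''m'' 0 s"
  define I where "I i s' \<longleftrightarrow> covering r (narr s' ''cov'') i \<and>
    nvar s' ''m'' = card (reps (narr s' ''cov'') i)" for i and s' :: store
  have "bounded_run n (For ''i'' ''n'' ?c) ?s (\<lambda>s'. covering r (narr s' ''cov'') n \<and>
    nvar s' ''m'' = card (reps (narr s' ''cov'') n))"
  proof (rule bounded_run_For[where N = n and I = I])
    show "I 0 (set_nvar ''i'' 0 ?s)"
      using s by (simp add: I_def covering_def reps_def separated_def)
  next
    fix i s' assume i: "i < n" and I: "I i s'" and s': "nvar s' ''i'' = i"
      and ag: "agree (For ''i'' ''n'' ?c) ?s s'"
    have in': "inputs s'" by (rule inputs_agree[OF inputs_set_nvar[OF s(1)] ag]) simp_all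
    have r': "rvar s' ''r'' = r" using s by (simp add: agreeD[OF ag])
    let ?cov = "narr s' ''cov''"
    show "bounded_run n ?c s' (\<lambda>s''. I (Suc i) (set_nvar ''i'' (Suc i) s''))"
    proof (rule bounded_run_Cond)
      assume "\<not> bval (NLess (NArr ''cov'' (NVar ''i'')) (NConst 1)) s'"
      then have "?cov i \<noteq> 0" using s' by simp
      then show "bounded_run n Skip s' (\<lambda>s''. I (Suc i) (set_nvar ''i'' (Suc i) s''))"
        using I covering_skip[of r ?cov i] i by (intro bounded_run_loop_free) (simp_all add: I_def)
    next
      assume "bval (NLess (NArr ''cov'' (NVar ''i'')) (NConst 1)) s'"
      then have 0: "?cov i = 0" using s' by simp
      let ?s' = "set_nvar ''m'' (nvar s' ''m'' + 1) s'"
      have "bounded_run n cover_com ?s' (\<lambda>s''. I (Suc i) (set_nvar ''i'' (Suc i) s''))"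
      proof (rule bounded_run_mono[OF cover_correct[where i = i and r = r]])
        fix s'' assume ag: "agree cover_com ?s' s''" and eq: "narr s'' ''cov'' =
          (\<lambda>x. if x < n \<and> narr ?s' ''cov'' x = 0 \<and> D i x \<le> 2 * r then i + 1 else narr ?s' ''cov'' x)"
        have m: "nvar s'' ''m'' = nvar s' ''m'' + 1" by (simp add: agreeD[OF ag])
        have cov: "covering r ?cov i" "nvar s' ''m'' = card (reps ?cov i)" using I by (simp_all add: I_def)
        have "narr s'' ''cov'' = (\<lambda>x. if x < n \<and> ?cov x = 0 \<and> D i x \<le> 2 * r then i + 1 else ?cov x)"
          unfolding eq by (rule ext) simp
        note ext = covering_extend[OF cov(1) 0 i s(3) this]
        have "finite (reps ?cov i)" "i \<notin> reps ?cov i" by (auto simp: reps_def)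
        then show "I (Suc i) (set_nvar ''i'' (Suc i) s'')"
          using ext m cov by (simp add: I_def)
      qed (use in' r' s' i in \<open>simp_all add: inputs_set_nvar\<close>)
      then show "bounded_run n (NAssign ''m'' (NPlus (NVar ''m'') (NConst 1)) ;; cover_com) s'
          (\<lambda>s''. I (Suc i) (set_nvar ''i'' (Suc i) s''))"
        by (intro bounded_run_Seq bounded_run_loop_free[of "NAssign _ _"]) simp_all
    qed
  qed (use s in \<open>simp_all add: I_def inputs_def\<close>)
  then show ?thesis unfolding reps_com_def
    by (intro bounded_run_Seq bounded_run_loop_free[of "NAssign _ _"]) simp_all
qed

lemma weights_correct:
  assumes s: "inputs s" "rvar s ''r'' = r" "\<And>i. i < n \<Longrightarrow> narr s ''w'' i = 0"
  shows "bounded_run n weights_com s (\<lambda>s'. \<forall>h<n. narr s' ''w'' h = weight r h)"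
  unfolding weights_com_def
proof (rule bounded_run_For[where N = n and
      I = "\<lambda>i s'. \<forall>h<n. narr s' ''w'' h = card {x. x < i \<and> lH x = h \<and> D x h \<le> r}"])
  let ?c = "Cond (BNot (RLess (RVar ''r'') (dist_exp ''i'' (NArr ''lH'' (NVar ''i'')))))
       (NStore ''w'' (NArr ''lH'' (NVar ''i'')) (NPlus (NArr ''w'' (NArr ''lH'' (NVar ''i''))) (NConst 1)))
       Skip"
  fix i s' assume i: "i < n" and I: "\<forall>h<n. narr s' ''w'' h = card {x. x < i \<and> lH x = h \<and> D x h \<le> r}"
    and s': "nvar s' ''i'' = i" and ag: "agree (For ''i'' ''n'' ?c) s s'"
  have in': "inputs s'" by (rule inputs_agree[OF s(1) ag]) simp_all
  have r': "rvar s' ''r'' = r" using s by (simp add: agreeD[OF ag])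
  have l: "narr s' ''lH'' i = lH i" "lH i < n" and d: "rarr s' ''d'' (narr s' ''row'' i + lH i) = D i (lH i)"
    using in' i lH_less by (auto simp: inputs_def)
  have "{x. x < Suc i \<and> lH x = h \<and> D x h \<le> r} =
      (if lH i = h \<and> D i h \<le> r then insert i {x. x < i \<and> lH x = h \<and> D x h \<le> r}
       else {x. x < i \<and> lH x = h \<and> D x h \<le> r})" for h
    by (auto simp: less_Suc_eq)
  then have "card {x. x < Suc i \<and> lH x = h \<and> D x h \<le> r} =
      card {x. x < i \<and> lH x = h \<and> D x h \<le> r} + (if lH i = h \<and> D i (lH i) \<le> r then 1 else 0)" for h
    by auto
  then show "bounded_run n ?c s' (\<lambda>s''. \<forall>h<n. narr (set_nvar ''i'' (Suc i) s'') ''w'' h =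
      card {x. x < Suc i \<and> lH x = h \<and> D x h \<le> r})"
    using I l d s' r' by (intro bounded_run_loop_free) auto
qed (use s in \<open>simp_all add: inputs_def weight_def\<close>)

lemma centers_correct:
  assumes s: "inputs s" "rvar s ''r'' = r" "0 \<le> r" "covering r cov n" "narr s ''cov'' = cov"
    "\<And>h. h < n \<Longrightarrow> narr s ''w'' h = weight r h" "\<And>i. i < n \<Longrightarrow> narr s ''C0'' i = 0"
  shows "bounded_run n centers_com s (\<lambda>s'.
    (\<forall>x\<in>reps cov n. best_center r x (narr s' ''cen'' x)) \<and>
    (\<forall>x<n. narr s' ''C0'' x \<noteq> 0 \<longleftrightarrow> x \<in> narr s' ''cen'' ` reps cov n))"
proof -
  let ?p = "BAnd (NLess (NConst 0) (NArr ''H'' (NVar ''j'')))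
          (BNot (RLess (RVar ''r'') (dist_exp ''i'' (NVar ''j''))))"
  let ?st = "NStore ''cen'' (NVar ''i'') (NVar ''best'') ;; NStore ''C0'' (NVar ''best'') (NConst 1)"
  let ?b = "NAssign ''best'' (NVar ''i'') ;; heaviest_com ?p ;; ?st"
  let ?c = "Cond (BAnd (NLess (NVar ''i'') (NArr ''cov'' (NVar ''i'')))
         (NLess (NArr ''cov'' (NVar ''i'')) (NPlus (NVar ''i'') (NConst 2)))) ?b Skip"
  define I where "I i s' \<longleftrightarrow> (\<forall>x\<in>reps cov i. best_center r x (narr s' ''cen'' x)) \<and>
    (\<forall>x<n. narr s' ''C0'' x \<noteq> 0 \<longleftrightarrow> x \<in> narr s' ''cen'' ` reps cov i)" for i and s' :: store
  show ?thesis unfolding centers_com_def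
  proof (rule bounded_run_For[where N = n and I = I])
    show "I 0 (set_nvar ''i'' 0 s)" using s by (simp add: I_def reps_def)
  next
    fix i s' assume i: "i < n" and I: "I i s'" and s': "nvar s' ''i'' = i"
      and ag: "agree (For ''i'' ''n'' ?c) s s'"
    have in': "inputs s'" by (rule inputs_agree[OF s(1) ag]) simp_all
    have r': "rvar s' ''r'' = r" "narr s' ''cov'' = cov" "\<And>h. h < n \<Longrightarrow> narr s' ''w'' h = weight r h"
      using s by (simp_all add: agreeD[OF ag])
    show "bounded_run n ?c s' (\<lambda>s''. I (Suc i) (set_nvar ''i'' (Suc i) s''))"
    proof (rule bounded_run_Cond)
      assume "\<not> bval (BAnd (NLess (NVar ''i'') (NArr ''cov'' (NVar ''i'')))
         (NLess (NArr ''cov'' (NVar ''i'')) (NPlus (NVar ''i'') (NConst 2)))) s'"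
      then have "reps cov (Suc i) = reps cov i"
        using s' r' by (auto simp: reps_def less_Suc_eq)
      then show "bounded_run n Skip s' (\<lambda>s''. I (Suc i) (set_nvar ''i'' (Suc i) s''))"
        using I by (intro bounded_run_loop_free) (simp_all add: I_def)
    next
      assume "bval (BAnd (NLess (NVar ''i'') (NArr ''cov'' (NVar ''i'')))
         (NLess (NArr ''cov'' (NVar ''i'')) (NPlus (NVar ''i'') (NConst 2)))) s'"
      then have reps: "reps cov (Suc i) = insert i (reps cov i)"
        using s' r' by (auto simp: reps_def less_Suc_eq)
      let ?s' = "set_nvar ''best'' i s'"
      have "bounded_run n (heaviest_com ?p) ?s'
        (\<lambda>s''. bounded_run n ?st s'' (\<lambda>s''. I (Suc i) (set_nvar ''i'' (Suc i) s'')))"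
      proof (rule bounded_run_mono[OF heaviest_correct[where P = "\<lambda>j. j \<in> H \<and> D i j \<le> r"]])
        fix s'' assume "agree (heaviest_com ?p) ?s' s''" "nvar s'' ''j'' < n"
        moreover have "inputs s''"
          by (rule inputs_agree[OF inputs_set_nvar[OF in'] calculation(1)]) simp_all
        ultimately show "bval ?p s'' \<longleftrightarrow> nvar s'' ''j'' \<in> H \<and> D i (nvar s'' ''j'') \<le> r"
          using r' s' i agreeD(1)[of "heaviest_com ?p" ?s' s'' "''i''"]
            agreeD(3)[of "heaviest_com ?p" ?s' s'' "''r''"] by (auto simp: inputs_def)
      next
        fix s'' assume ag: "agree (heaviest_com ?p) ?s' s''" and h: "
          (\<forall>j<n. \<not> (j \<in> H \<and> D i j \<le> r)) \<and> nvar s'' ''best'' = nvar ?s' ''best'' \<or>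
          nvar s'' ''best'' < n \<and> (nvar s'' ''best'' \<in> H \<and> D i (nvar s'' ''best'') \<le> r) \<and>
            (\<forall>j<n. j \<in> H \<and> D i j \<le> r \<longrightarrow> narr ?s' ''w'' j \<le> narr ?s' ''w'' (nvar s'' ''best''))"
        let ?c = "nvar s'' ''best''"
        \<comment> \<open>The two outcomes of the scan are the two branches of
          \<open>best_center\<close>; without candidates \<open>best\<close> still holds the preset
          \<open>i\<close>.\<close>
        have bc: "best_center r i ?c"
          using h r' H_sub unfolding best_center_def by (auto simp: subset_iff)
        have c: "?c < n" using best_center_near[OF bc i s(3)] by simp
        have s'': "nvar s'' ''i'' = i" "narr s'' ''cen'' = narr s' ''cen''" "narr s'' ''C0'' = narr s' ''C0''"
          using s' by (simp_all add: agreeD[OF ag])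
        have "i \<notin> reps cov i" by (simp add: reps_def)
        then have im: "((narr s' ''cen'')(i := ?c)) ` reps cov i = narr s' ''cen'' ` reps cov i"
          by (intro image_cong) auto
        have "I (Suc i) (set_nvar ''i'' (Suc i) (result ?st s''))"
          using I bc c s'' \<open>i \<notin> reps cov i\<close> im by (auto simp: I_def reps)
        then show "bounded_run n ?st s'' (\<lambda>s''. I (Suc i) (set_nvar ''i'' (Suc i) s''))"
          by (intro bounded_run_loop_free) simp_all
      qed (use in' in \<open>simp_all add: inputs_def\<close>)
      from bounded_run_Seq[OF this]
      show "bounded_run n ?b s' (\<lambda>s''. I (Suc i) (set_nvar ''i'' (Suc i) s''))"
        using s' by (intro bounded_run_Seq[of _ "NAssign _ _"] bounded_run_loop_free[of "NAssign _ _"]) simp_all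
    qed
  qed (use s in \<open>simp_all add: I_def inputs_def\<close>)
qed

lemma heaviest_insert:
  assumes E: "heaviest r R E" and c: "c \<in> R - E" "\<And>j. j \<in> R - E \<Longrightarrow> weight r j \<le> weight r c"
  shows "heaviest r R (insert c E)"
  using assms unfolding heaviest_def by auto

lemma extra_correct:
  assumes s: "inputs s" "B \<subseteq> {..<n}" "card B = nvar s ''m''"
    "\<And>h. h < n \<Longrightarrow> narr s ''w'' h = weight r h"
    "\<And>x. x < n \<Longrightarrow> narr s ''C0'' x \<noteq> 0 \<longleftrightarrow> x \<in> B"
  shows "bounded_run n extra_com s (\<lambda>s'. \<exists>E. heaviest r (H - B) E \<and> card E = k - card B \<and>
    (\<forall>x<n. narr s' ''C0'' x \<noteq> 0 \<longleftrightarrow> x \<in> B \<union> E))"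
proof -
  let ?p = "BAnd (NLess (NConst 0) (NArr ''H'' (NVar ''j'')))
        (BNot (NLess (NConst 0) (NArr ''C0'' (NVar ''j''))))"
  let ?st = "NStore ''C0'' (NVar ''best'') (NConst 1)"
  let ?c = "NAssign ''best'' (NConst 0) ;; heaviest_com ?p ;; ?st"
  let ?s = "set_nvar ''ex'' (k - card B) s"
  define I where "I q s' \<longleftrightarrow> (\<exists>E. heaviest r (H - B) E \<and> card E = q \<and>
    (\<forall>x<n. narr s' ''C0'' x \<noteq> 0 \<longleftrightarrow> x \<in> B \<union> E))" for q and s' :: store
  have "bounded_run n (For ''q'' ''ex'' ?c) ?s (I (k - card B))"
  proof (rule bounded_run_For[where N = "k - card B" and I = I])
    show "k - card B \<le> n" using k_le_n by simp
    show "I 0 (set_nvar ''q'' 0 ?s)" using s by (auto simp: I_def heaviest_def intro!: exI[of _ "{}"])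
  next
    fix q s' assume q: "q < k - card B" and I: "I q s'" and s': "nvar s' ''q'' = q"
      and ag: "agree (For ''q'' ''ex'' ?c) ?s s'"
    from I obtain E where E: "heaviest r (H - B) E" "card E = q"
      "\<And>x. x < n \<Longrightarrow> narr s' ''C0'' x \<noteq> 0 \<longleftrightarrow> x \<in> B \<union> E" by (auto simp: I_def)
    have EH: "E \<subseteq> H - B" and finE: "finite E"
      using E(1) finite_H finite_subset[of E "H - B"] by (auto simp: heaviest_def)
    have finB: "finite B" using s(2) finite_subset by blast
    \<comment> \<open>As \<open>q < k - card B\<close>, fewer than \<open>k = card H\<close> indices
      are taken. So the scan finds a candidate, and the preset 0 never enters the solution.\<close>
    have "card (B \<union> E) \<le> card B + q" using card_Un_le[of B E] E by simp
    then have "\<not> H \<subseteq> B \<union> E" using card_mono[of "B \<union> E" H] finE finB q card_H by auto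
    then obtain h0 where h0: "h0 \<in> H" "h0 \<notin> B \<union> E" by blast
    have in': "inputs s'" by (rule inputs_agree[OF inputs_set_nvar[OF s(1)] ag]) simp_all
    have w: "\<And>h. h < n \<Longrightarrow> narr s' ''w'' h = weight r h"
      using s by (simp_all add: agreeD[OF ag])
    let ?s' = "set_nvar ''best'' 0 s'"
    have "bounded_run n (heaviest_com ?p) ?s'
      (\<lambda>s''. bounded_run n ?st s'' (\<lambda>s''. I (Suc q) (set_nvar ''q'' (Suc q) s'')))"
    proof (rule bounded_run_mono[OF heaviest_correct[where P = "\<lambda>j. j \<in> H - B - E"]])
      fix s'' assume ag: "agree (heaviest_com ?p) ?s' s''" and j: "nvar s'' ''j'' < n"
      have "inputs s''" by (rule inputs_agree[OF inputs_set_nvar[OF in'] ag]) simp_all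
      moreover have "narr s'' ''C0'' = narr s' ''C0''" by (simp add: agreeD[OF ag])
      ultimately show "bval ?p s'' \<longleftrightarrow> nvar s'' ''j'' \<in> H - B - E"
        using E(3)[OF j] j by (auto simp: inputs_def)
    next
      fix s'' assume ag: "agree (heaviest_com ?p) ?s' s''" and h: "
        (\<forall>j<n. j \<notin> H - B - E) \<and> nvar s'' ''best'' = nvar ?s' ''best'' \<or>
        nvar s'' ''best'' < n \<and> nvar s'' ''best'' \<in> H - B - E \<and>
          (\<forall>j<n. j \<in> H - B - E \<longrightarrow> narr ?s' ''w'' j \<le> narr ?s' ''w'' (nvar s'' ''best''))"
      let ?b = "nvar s'' ''best''"
      have h: "?b < n" "?b \<in> H - B - E" "\<And>j. j \<in> H - B - E \<Longrightarrow> weight r j \<le> weight r ?b"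
        using h h0 H_sub w by (auto simp: subset_iff)
      have C0: "narr s'' ''C0'' = narr s' ''C0''" by (simp add: agreeD[OF ag])
      have "heaviest r (H - B) (insert ?b E)" by (rule heaviest_insert[OF E(1)]) (use h in auto)
      moreover have "card (insert ?b E) = Suc q" using h finE E by simp
      ultimately have "I (Suc q) (set_nvar ''q'' (Suc q) (result ?st s''))"
        unfolding I_def using h E(3) C0 by (intro exI[of _ "insert ?b E"]) auto
      then show "bounded_run n ?st s'' (\<lambda>s''. I (Suc q) (set_nvar ''q'' (Suc q) s''))"
        by (intro bounded_run_loop_free) simp_all
    qed (use in' in \<open>simp_all add: inputs_def\<close>)
    from bounded_run_Seq[OF this]
    show "bounded_run n ?c s' (\<lambda>s''. I (Suc q) (set_nvar ''q'' (Suc q) s''))"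
      by (intro bounded_run_Seq[of _ "NAssign _ _"] bounded_run_loop_free[of "NAssign _ _"]) simp_all
  qed simp_all
  then show ?thesis unfolding extra_com_def I_def
    using s by (intro bounded_run_Seq[of _ "NAssign _ _"] bounded_run_loop_free[of "NAssign _ _"])
      (simp_all add: inputs_def)
qed

lemma label_correct:
  assumes s: "inputs s" "rvar s ''r'' = r" "\<And>x. x < n \<Longrightarrow> narr s ''C0'' x \<noteq> 0 \<longleftrightarrow> x \<in> C"
  shows "bounded_run n label_com s (\<lambda>s'.
    (\<forall>x<n. narr s' ''l0'' x = (if lH x \<in> C \<and> D x (lH x) \<le> r then lH x
       else narr s ''cen'' (narr s ''cov'' x - 1))) \<and>
    nvar s' ''cnt'' = card {x. x < n \<and> \<not> (lH x \<in> C \<and> D x (lH x) \<le> r)})"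
proof -
  let ?keep = "\<lambda>x. lH x \<in> C \<and> D x (lH x) \<le> r"
  let ?c = "Cond (BAnd (NLess (NConst 0) (NArr ''C0'' (NArr ''lH'' (NVar ''i''))))
         (BNot (RLess (RVar ''r'') (dist_exp ''i'' (NArr ''lH'' (NVar ''i''))))))
       (NStore ''l0'' (NVar ''i'') (NArr ''lH'' (NVar ''i'')))
       (NStore ''l0'' (NVar ''i'') (NArr ''cen'' (NMinus (NArr ''cov'' (NVar ''i'')) (NConst 1))) ;;
        NAssign ''cnt'' (NPlus (NVar ''cnt'') (NConst 1)))"
  let ?s = "set_nvar ''cnt'' 0 s"
  define I where "I i s' \<longleftrightarrow>
    (\<forall>x<i. narr s' ''l0'' x = (if ?keep x then lH x else narr s ''cen'' (narr s ''cov'' x - 1))) \<and>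
    nvar s' ''cnt'' = card {x. x < i \<and> \<not> ?keep x}" for i and s' :: store
  have "bounded_run n (For ''i'' ''n'' ?c) ?s (I n)"
  proof (rule bounded_run_For[where N = n and I = I])
    show "I 0 (set_nvar ''i'' 0 ?s)" by (simp add: I_def)
  next
    fix i s' assume i: "i < n" and I: "I i s'" and s': "nvar s' ''i'' = i"
      and ag: "agree (For ''i'' ''n'' ?c) ?s s'"
    have in': "inputs s'" by (rule inputs_agree[OF inputs_set_nvar[OF s(1)] ag]) simp_all
    have l: "narr s' ''lH'' i = lH i" "lH i < n" and d: "rarr s' ''d'' (narr s' ''row'' i + lH i) = D i (lH i)"
      using in' i lH_less by (auto simp: inputs_def)
    have same: "rvar s' ''r'' = r" "narr s' ''cen'' = narr s ''cen''" "narr s' ''cov'' = narr s ''cov''"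
      "narr s' ''C0'' = narr s ''C0''" using s by (simp_all add: agreeD[OF ag])
    have C0: "0 < narr s ''C0'' (lH i) \<longleftrightarrow> lH i \<in> C" using s(3)[OF l(2)] by simp
    have "{x. x < Suc i \<and> \<not> ?keep x} =
        (if ?keep i then {x. x < i \<and> \<not> ?keep x} else insert i {x. x < i \<and> \<not> ?keep x})"
      by (auto simp: less_Suc_eq)
    then have card: "card {x. x < Suc i \<and> \<not> ?keep x} =
        card {x. x < i \<and> \<not> ?keep x} + (if ?keep i then 0 else 1)" by simp
    have "I (Suc i) (set_nvar ''i'' (Suc i) (result ?c s'))"
    proof (cases "?keep i")
      case True
      then have "bval (BAnd (NLess (NConst 0) (NArr ''C0'' (NArr ''lH'' (NVar ''i''))))
         (BNot (RLess (RVar ''r'') (dist_exp ''i'' (NArr ''lH'' (NVar ''i'')))))) s'"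
        using s' l d same C0 by simp
      then show ?thesis using I s' l True card unfolding I_def by (auto simp: less_Suc_eq)
    next
      case False
      then have "\<not> bval (BAnd (NLess (NConst 0) (NArr ''C0'' (NArr ''lH'' (NVar ''i''))))
         (BNot (RLess (RVar ''r'') (dist_exp ''i'' (NArr ''lH'' (NVar ''i'')))))) s'"
        using s' l d same C0 by auto
      then show ?thesis using I s' False card same unfolding I_def by (auto simp: less_Suc_eq)
    qed
    then show "bounded_run n ?c s' (\<lambda>s''. I (Suc i) (set_nvar ''i'' (Suc i) s''))"
      by (intro bounded_run_loop_free) simp_all
  qed (use s in \<open>simp_all add: inputs_def\<close>)
  then show ?thesis unfolding label_com_def I_def
    by (intro bounded_run_Seq[of _ "NAssign _ _"] bounded_run_loop_free[of "NAssign _ _"]) simp_all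
qed

text \<open>Soundness of acceptance needs only the triangle inequality and counting; completeness is
  where \<open>kept_weight_maximal\<close> and the bound on separated sets enter.\<close>

lemma selection_correct:
  assumes r: "0 \<le> r" and cov: "covering r cov n" and S: "S = reps cov n"
    and cen: "\<And>s. s \<in> S \<Longrightarrow> best_center r s (cen s)"
    and E: "heaviest r (H - cen ` S) E" "card E = k - card S"
    and C: "C = cen ` S \<union> E"
    and l: "\<And>x. x < n \<Longrightarrow> l x = (if lH x \<in> C \<and> D x (lH x) \<le> r then lH x else cen (cov x - 1))"
    and cnt: "cnt = card {x. x < n \<and> \<not> (lH x \<in> C \<and> D x (lH x) \<le> r)}"
  shows "card S \<le> k \<Longrightarrow> cnt \<le> b \<Longrightarrow> feasible C l \<and> cost_le (3 * r) l"
    and "feasible C' l' \<Longrightarrow> cost_le r l' \<Longrightarrow> card S \<le> k \<and> cnt \<le> b"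
proof -
  have sep: "separated r S" using cov S by (simp add: covering_def)
  then have Sn: "S \<subseteq> {..<n}" and finS: "finite S" using finite_subset by (auto simp: separated_def)
  have ER: "E \<subseteq> H - cen ` S" using E by (simp add: heaviest_def)
  have finE: "finite E" using ER finite_H finite_subset by blast
  have cenS: "cen s < n" "D s (cen s) \<le> r" if "s \<in> S" for s
    using best_center_near[OF cen[OF that]] that Sn r by auto
  have Cn: "C \<subseteq> {..<n}" using C cenS ER H_sub by auto
  have inj: "inj_on cen S" using separated_inj_on[OF sep order_refl] cenS by blast
  let ?keep = "\<lambda>x. lH x \<in> C \<and> D x (lH x) \<le> r"
  {
    assume k: "card S \<le> k" and b: "cnt \<le> b"
    have "card C = card (cen ` S) + card E"
      unfolding C using finS finE ER by (intro card_Un_disjoint) auto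
    then have card: "card C = k" using E k inj by (simp add: card_image)
    have rep: "cov x - 1 \<in> S" "D (cov x - 1) x \<le> 2 * r" if "x < n" for x
      using cov that S by (auto simp: covering_def)
    have lC: "l x \<in> C" if "x < n" for x using l[OF that] rep[OF that] C by auto
    have "D x (l x) \<le> 3 * r" if x: "x < n" for x
    proof (cases "?keep x")
      case True
      then show ?thesis using l[OF x] r by simp
    next
      case False
      let ?s = "cov x - 1"
      have "D x (cen ?s) \<le> D x ?s + D ?s (cen ?s)"
        using rep[OF x] cenS Sn x by (intro D_triangle) auto
      also have "\<dots> \<le> 2 * r + r" using rep[OF x] cenS D_sym[of x ?s] by (intro add_mono) auto
      finally show ?thesis using l[OF x] False by simp
    qed
    \<comment> \<open>Every changed label belongs to a point that was not kept, hence counted by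
      \<open>cnt\<close>.\<close>
    moreover have "card {i. i < n \<and> lH i \<noteq> l i} \<le> cnt"
      unfolding cnt using l by (intro card_mono) auto
    ultimately show "feasible C l \<and> cost_le (3 * r) l"
      using Cn card lC b by (auto simp: feasible_def cost_le_def)
  next
    assume f: "feasible C' l'" "cost_le r l'"
    have "card S \<le> k" by (rule card_separated_le[OF sep f])
    moreover have "n \<le> b + sum (weight r) ((cen ` S \<inter> H) \<union> E)"
      by (rule kept_weight_maximal[OF r sep cen E f])
    \<comment> \<open>All labels lie in \<open>H\<close>, so chosen centers outside \<open>H\<close>
      carry none and may be dropped.\<close>
    moreover have "sum (weight r) ((cen ` S \<inter> H) \<union> E) = card {x. x < n \<and> ?keep x}"
    proof -
      have "lH x \<in> (cen ` S \<inter> H) \<union> E \<longleftrightarrow> lH x \<in> C" if "x < n" for x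
        using lH[OF that] C by auto
      then have "{x. x < n \<and> lH x \<in> (cen ` S \<inter> H) \<union> E \<and> D x (lH x) \<le> r} = {x. x < n \<and> ?keep x}"
        by blast
      moreover have "finite ((cen ` S \<inter> H) \<union> E)" using finS finE by simp
      ultimately show ?thesis by (simp only: sum_weight)
    qed
    moreover have "card {x. x < n \<and> ?keep x} + cnt = n"
    proof -
      have "{..<n} \<inter> {x. ?keep x} = {x. x < n \<and> ?keep x}" "{..<n} - {x. ?keep x} = {x. x < n \<and> \<not> ?keep x}"
        by auto
      then show ?thesis using card_Int_Diff[of "{..<n}" "{x. ?keep x}"] cnt by simp
    qed
    ultimately show "card S \<le> k \<and> cnt \<le> b" by linarith
  }
qed

text \<open>Guesses below a third of the optimum must fail and guesses from the optimum on must
  succeed; in between, the two implications leave the answer open.\<close>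

lemma check_correct:
  assumes s: "inputs s" "rvar s ''r'' = r" "0 \<le> r"
  shows "bounded_run n check_com s (\<lambda>s'.
    (nvar s' ''ok'' \<noteq> 0 \<longrightarrow> feasible {x. x < n \<and> narr s' ''C0'' x \<noteq> 0} (narr s' ''l0'') \<and>
      cost_le (3 * r) (narr s' ''l0'')) \<and>
    (nvar s' ''ok'' = 0 \<longrightarrow> \<not> (\<exists>C l. feasible C l \<and> cost_le r l)))"
  (is "bounded_run n _ s ?Q")
  unfolding check_com_def
proof (rule bounded_run_Seq, rule bounded_run_mono[OF reset_correct[OF s(1)]])
  fix s1 assume ag: "agree reset_com s s1"
    and p1: "\<forall>i<n. narr s1 ''cov'' i = 0 \<and> narr s1 ''C0'' i = 0 \<and> narr s1 ''w'' i = 0"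
  have in1: "inputs s1" "rvar s1 ''r'' = r"
    using inputs_agree[OF s(1) ag] s by (simp_all add: agreeD[OF ag])
  show "bounded_run n (reps_com ;; weights_com ;; centers_com ;; extra_com ;; label_com ;; accept_com) s1 ?Q"
  proof (rule bounded_run_Seq, rule bounded_run_mono[OF reps_correct[OF in1 s(3)]])
    fix s2 assume ag: "agree reps_com s1 s2" and p2: "covering r (narr s2 ''cov'') n \<and>
        nvar s2 ''m'' = card (reps (narr s2 ''cov'') n)"
    define cov where "cov = narr s2 ''cov''"
    define S where "S = reps cov n"
    have in2: "inputs s2" "rvar s2 ''r'' = r"
      and C2: "\<forall>i<n. narr s2 ''C0'' i = 0" "\<forall>i<n. narr s2 ''w'' i = 0"
      using inputs_agree[OF in1(1) ag] in1 p1 by (simp_all add: agreeD[OF ag])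
    have cov: "covering r cov n" and m2: "nvar s2 ''m'' = card S" using p2 by (simp_all add: cov_def S_def)
    show "bounded_run n (weights_com ;; centers_com ;; extra_com ;; label_com ;; accept_com) s2 ?Q"
    proof (rule bounded_run_Seq, rule bounded_run_mono[OF weights_correct[OF in2]])
      fix s3 assume ag: "agree weights_com s2 s3" and p3: "\<forall>h<n. narr s3 ''w'' h = weight r h"
      have in3: "inputs s3" "rvar s3 ''r'' = r" and C3: "\<forall>i<n. narr s3 ''C0'' i = 0"
        and cov3: "narr s3 ''cov'' = cov" and m3: "nvar s3 ''m'' = card S"
        using inputs_agree[OF in2(1) ag] in2 C2 m2 by (simp_all add: agreeD[OF ag] cov_def)
      show "bounded_run n (centers_com ;; extra_com ;; label_com ;; accept_com) s3 ?Q"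
      proof (rule bounded_run_Seq, rule bounded_run_mono[OF centers_correct[OF in3 s(3) cov cov3]])
        fix s4 assume ag: "agree centers_com s3 s4"
          and p4: "(\<forall>x\<in>reps cov n. best_center r x (narr s4 ''cen'' x)) \<and>
            (\<forall>x<n. (narr s4 ''C0'' x \<noteq> 0) = (x \<in> narr s4 ''cen'' ` reps cov n))"
        define cen where "cen = narr s4 ''cen''"
        have cen: "best_center r x (cen x)" if "x \<in> S" for x using p4 that by (simp add: S_def cen_def)
        have in4: "inputs s4" "rvar s4 ''r'' = r" and cov4: "narr s4 ''cov'' = cov"
          and m4: "nvar s4 ''m'' = card S" and w4: "\<forall>h<n. narr s4 ''w'' h = weight r h"
          using inputs_agree[OF in3(1) ag] in3 cov3 m3 p3 by (simp_all add: agreeD[OF ag])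
        have Sn: "S \<subseteq> {..<n}" and sep: "separated r S" using cov by (auto simp: S_def covering_def separated_def)
        have cenS: "cen x < n \<and> D x (cen x) \<le> r" if "x \<in> S" for x
          using best_center_near[OF cen[OF that] _ s(3)] Sn that by auto
        have cS: "card (cen ` S) = card S"
          using separated_inj_on[OF sep order_refl cenS] by (rule card_image)
        show "bounded_run n (extra_com ;; label_com ;; accept_com) s4 ?Q"
        proof (rule bounded_run_Seq, rule bounded_run_mono[OF extra_correct[OF in4(1), of "cen ` S" r]])
          show "cen ` S \<subseteq> {..<n}" using cenS by auto
          show "card (cen ` S) = nvar s4 ''m''" using cS m4 by simp
          show "narr s4 ''w'' h = weight r h" if "h < n" for h using w4 that by simp
          show "(narr s4 ''C0'' x \<noteq> 0) = (x \<in> cen ` S)" if "x < n" for x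
            using p4 that by (simp add: cen_def S_def)
        next
          fix s5 assume ag: "agree extra_com s4 s5" and
            "\<exists>E. heaviest r (H - cen ` S) E \<and> card E = k - card (cen ` S) \<and>
              (\<forall>x<n. (narr s5 ''C0'' x \<noteq> 0) = (x \<in> cen ` S \<union> E))"
          then obtain E where E: "heaviest r (H - cen ` S) E" "card E = k - card S"
            and C5: "\<forall>x<n. (narr s5 ''C0'' x \<noteq> 0) = (x \<in> cen ` S \<union> E)" using cS by auto
          define C where "C = cen ` S \<union> E"
          have CC5: "(narr s5 ''C0'' x \<noteq> 0) = (x \<in> C)" if "x < n" for x using C5 that by (simp add: C_def)
          have in5: "inputs s5" "rvar s5 ''r'' = r" and cov5: "narr s5 ''cov'' = cov"
            and m5: "nvar s5 ''m'' = card S" and cen5: "narr s5 ''cen'' = cen"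
            using inputs_agree[OF in4(1) ag] in4 cov4 m4 by (simp_all add: agreeD[OF ag] cen_def)
          show "bounded_run n (label_com ;; accept_com) s5 ?Q"
          proof (rule bounded_run_Seq, rule bounded_run_mono[OF label_correct[OF in5 CC5]])
            fix s6 assume ag: "agree label_com s5 s6" and
              p6: "(\<forall>x<n. narr s6 ''l0'' x = (if lH x \<in> C \<and> D x (lH x) \<le> r then lH x
                   else narr s5 ''cen'' (narr s5 ''cov'' x - 1))) \<and>
                nvar s6 ''cnt'' = card {x. x < n \<and> \<not> (lH x \<in> C \<and> D x (lH x) \<le> r)}"
            have in6: "inputs s6" and m6: "nvar s6 ''m'' = card S"
              and C6: "\<forall>x<n. (narr s6 ''C0'' x \<noteq> 0) = (x \<in> C)"
              using inputs_agree[OF in5(1) ag] m5 CC5 by (simp_all add: agreeD[OF ag])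
            have l: "narr s6 ''l0'' x = (if lH x \<in> C \<and> D x (lH x) \<le> r then lH x else cen (cov x - 1))"
              if "x < n" for x using p6 that cen5 cov5 by simp
            have "E \<subseteq> H" using E by (auto simp: heaviest_def)
            then have "C \<subseteq> {..<n}" using cenS H_sub by (auto simp: C_def)
            then have C: "{x. x < n \<and> narr s6 ''C0'' x \<noteq> 0} = C" using C6 by auto
            note sel = selection_correct[OF s(3) cov S_def cen E C_def l conjunct2[OF p6]]
            show "bounded_run n accept_com s6 ?Q"
              unfolding accept_com_def
            proof (intro bounded_run_Cond bounded_run_loop_free)
              assume "bval (BAnd (BNot (NLess (NVar ''k'') (NVar ''m'')))
                (BNot (NLess (NVar ''b'') (NVar ''cnt'')))) s6"
              then have "card S \<le> k" "nvar s6 ''cnt'' \<le> b" using m6 in6 by (auto simp: inputs_def)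
              then show "?Q (result (NAssign ''ok'' (NConst 1)) s6)" using sel(1) C by simp
            next
              assume "\<not> bval (BAnd (BNot (NLess (NVar ''k'') (NVar ''m'')))
                (BNot (NLess (NVar ''b'') (NVar ''cnt'')))) s6"
              then have "\<not> (card S \<le> k \<and> nvar s6 ''cnt'' \<le> b)" using m6 in6 by (auto simp: inputs_def)
              then show "?Q (result (NAssign ''ok'' (NConst 0)) s6)" using sel(2) by auto
            qed simp_all
          qed
        qed
      qed (use p3 C3 in simp_all)
    qed (use C2 in simp)
  qed (use p1 in simp)
qed

end

section \<open>The algorithm and its running time\<close>

text \<open>Repeated addition replaces multiplication; besides the row offsets it leaves
  \<open>n * n\<close> in \<open>N\<close>.\<close>

definition rows_com :: com where
  "rows_com = NAssign ''N'' (NConst 0) ;; For ''i'' ''n''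
     (NStore ''row'' (NVar ''i'') (NVar ''N'') ;; NAssign ''N'' (NPlus (NVar ''N'') (NVar ''n'')))"

definition copy_com :: com where
  "copy_com = For ''o'' ''N'' (RStore ''A'' (NVar ''o'') (RArr ''d'' (NVar ''o'')))"

text \<open>Later probes overwrite \<open>C0\<close> and \<open>l0\<close>, so an accepted solution
  is saved in separate arrays.\<close>

definition output_com :: com where
  "output_com = For ''i'' ''n''
     (NStore ''C'' (NVar ''i'') (NArr ''C0'' (NVar ''i'')) ;;
      NStore ''lC'' (NVar ''i'') (NArr ''l0'' (NVar ''i'')))"

definition probe_com :: com where
  "probe_com =
     (NAssign ''mid'' (NHalf (NPlus (NVar ''lo'') (NVar ''hi''))) ;;
      RAssign ''r'' (RArr ''A'' (NVar ''mid''))) ;;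
     check_com ;;
     Cond (NLess (NConst 0) (NVar ''ok''))
       (NAssign ''hi'' (NVar ''mid'') ;; output_com)
       (NAssign ''lo'' (NPlus (NVar ''mid'') (NConst 1)))"

definition search_com :: com where
  "search_com = (NAssign ''lo'' (NConst 0) ;; NAssign ''hi'' (NVar ''N'')) ;;
     Loop (NLess (NVar ''lo'') (NVar ''hi'')) probe_com"

definition cluster_com :: com where
  "cluster_com = rows_com ;; copy_com ;; sort_com ;; search_com"

lemma written_sort [simp]:
  "written_nvar sort_com = {''width'', ''i1'', ''u'', ''j1'', ''e'', ''o''}" "written_narr sort_com = {}"
  "written_rvar sort_com = {}" "written_rarr sort_com = {''A'', ''B''}"
  by (auto simp: sort_com_def merge_pass_com_def merge_step_com_def next_block_com_def)

lemma written_check [simp]: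
  "written_nvar check_com = {''i'', ''j'', ''m'', ''bw'', ''best'', ''ex'', ''q'', ''cnt'', ''ok''}"
  "written_narr check_com = {''cov'', ''C0'', ''w'', ''cen'', ''l0''}"
  "written_rvar check_com = {}" "written_rarr check_com = {}"
  by (auto simp: check_com_def)

lemma written_output [simp]:
  "written_nvar output_com = {''i''}" "written_narr output_com = {''C'', ''lC''}"
  "written_rvar output_com = {}" "written_rarr output_com = {}"
  by (auto simp: output_com_def)

lemma written_probe [simp]:
  "written_nvar probe_com =
     {''mid'', ''lo'', ''hi'', ''i'', ''j'', ''m'', ''bw'', ''best'', ''ex'', ''q'', ''cnt'', ''ok''}"
  "written_narr probe_com = {''cov'', ''C0'', ''w'', ''cen'', ''l0'', ''C'', ''lC''}"
  "written_rvar probe_com = {''r''}" "written_rarr probe_com = {}"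
  by (auto simp: probe_com_def)

lemma rows_correct:
  assumes n: "nvar s ''n'' = n"
  shows "bounded_run n rows_com s (\<lambda>s'. nvar s' ''N'' = n * n \<and> (\<forall>i<n. narr s' ''row'' i = i * n))"
proof -
  let ?c = "NStore ''row'' (NVar ''i'') (NVar ''N'') ;; NAssign ''N'' (NPlus (NVar ''N'') (NVar ''n''))"
  have "bounded_run n (For ''i'' ''n'' ?c) (set_nvar ''N'' 0 s)
    (\<lambda>s'. nvar s' ''N'' = n * n \<and> (\<forall>i<n. narr s' ''row'' i = i * n))"
  proof (rule bounded_run_For[where N = n and
        I = "\<lambda>j s'. nvar s' ''N'' = j * n \<and> (\<forall>i<j. narr s' ''row'' i = i * n)"])
    fix j s' assume I: "nvar s' ''N'' = j * n \<and> (\<forall>i<j. narr s' ''row'' i = i * n)"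
      and s': "nvar s' ''i'' = j" and ag: "agree (For ''i'' ''n'' ?c) (set_nvar ''N'' 0 s) s'"
    have "nvar s' ''n'' = n" using n by (simp add: agreeD[OF ag])
    then show "bounded_run n ?c s' (\<lambda>s''. nvar (set_nvar ''i'' (Suc j) s'') ''N'' = Suc j * n \<and>
        (\<forall>i<Suc j. narr (set_nvar ''i'' (Suc j) s'') ''row'' i = i * n))"
      using I s' by (intro bounded_run_loop_free) (auto simp: less_Suc_eq)
  qed (use n in simp_all)
  then show ?thesis unfolding rows_com_def
    by (intro bounded_run_Seq[of _ "NAssign _ _"] bounded_run_loop_free[of "NAssign _ _"]) simp_all
qed

lemma copy_correct:
  assumes N: "nvar s ''N'' = N"
  shows "bounded_run N copy_com s (\<lambda>s'. \<forall>i<N. rarr s' ''A'' i = rarr s ''d'' i)"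
  unfolding copy_com_def
proof (rule bounded_run_For[where N = N and I = "\<lambda>j s'. \<forall>i<j. rarr s' ''A'' i = rarr s ''d'' i"])
  let ?c = "RStore ''A'' (NVar ''o'') (RArr ''d'' (NVar ''o''))"
  fix j s' assume I: "\<forall>i<j. rarr s' ''A'' i = rarr s ''d'' i" and s': "nvar s' ''o'' = j"
    and ag: "agree (For ''o'' ''N'' ?c) s s'"
  have "rarr s' ''d'' = rarr s ''d''" by (simp add: agreeD[OF ag])
  then show "bounded_run N ?c s' (\<lambda>s''. \<forall>i<Suc j. rarr (set_nvar ''o'' (Suc j) s'') ''A'' i = rarr s ''d'' i)"
    using I s' by (intro bounded_run_loop_free) (auto simp: less_Suc_eq)
qed (use N in simp_all)

lemma output_correct:
  assumes n: "nvar s ''n'' = n"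
  shows "bounded_run n output_com s (\<lambda>s'. \<forall>i<n. narr s' ''C'' i = narr s ''C0'' i \<and> narr s' ''lC'' i = narr s ''l0'' i)"
  unfolding output_com_def
proof (rule bounded_run_For[where N = n and
      I = "\<lambda>j s'. \<forall>i<j. narr s' ''C'' i = narr s ''C0'' i \<and> narr s' ''lC'' i = narr s ''l0'' i"])
  let ?c = "NStore ''C'' (NVar ''i'') (NArr ''C0'' (NVar ''i'')) ;; NStore ''lC'' (NVar ''i'') (NArr ''l0'' (NVar ''i''))"
  fix j s' assume I: "\<forall>i<j. narr s' ''C'' i = narr s ''C0'' i \<and> narr s' ''lC'' i = narr s ''l0'' i"
    and s': "nvar s' ''i'' = j" and ag: "agree (For ''i'' ''n'' ?c) s s'"
  have "narr s' ''C0'' = narr s ''C0''" "narr s' ''l0'' = narr s ''l0''" by (simp_all add: agreeD[OF ag])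
  then show "bounded_run n ?c s' (\<lambda>s''. \<forall>i<Suc j. narr (set_nvar ''i'' (Suc j) s'') ''C'' i = narr s ''C0'' i \<and>
      narr (set_nvar ''i'' (Suc j) s'') ''lC'' i = narr s ''l0'' i)"
    using I s' by (intro bounded_run_loop_free) (auto simp: less_Suc_eq)
qed (use n in simp_all)

section \<open>Polynomial time from loop nesting\<close>

fun loop_depth :: "com \<Rightarrow> nat" where
  "loop_depth (Seq c c') = max (loop_depth c) (loop_depth c')"
| "loop_depth (Cond p c c') = max (loop_depth c) (loop_depth c')"
| "loop_depth (Loop p c) = Suc (loop_depth c)"
| "loop_depth _ = 0"

text \<open>Each enclosing loop contributes one factor \<open>m\<close>, and
  \<open>1 \<le> m\<close> absorbs constants and lower powers. \<open>K\<close> depends on the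
  program text alone.\<close>

lemma time_bound_polynomial: "\<exists>K. \<forall>m\<ge>1. time_bound m c \<le> K * m ^ loop_depth c"
proof (induction c)
  case (Seq c c')
  then obtain K K' where K: "\<forall>m\<ge>1. time_bound m c \<le> K * m ^ loop_depth c"
    "\<forall>m\<ge>1. time_bound m c' \<le> K' * m ^ loop_depth c'" by blast
  show ?case
  proof (intro exI[of _ "K + K'"] allI impI)
    fix m :: nat assume m: "1 \<le> m"
    let ?d = "loop_depth (Seq c c')"
    have "K * m ^ loop_depth c \<le> K * m ^ ?d" "K' * m ^ loop_depth c' \<le> K' * m ^ ?d"
      using m by (simp_all add: power_increasing)
    moreover have "time_bound m c \<le> K * m ^ loop_depth c" "time_bound m c' \<le> K' * m ^ loop_depth c'"
      using K m by auto
    ultimately show "time_bound m (Seq c c') \<le> (K + K') * m ^ ?d"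
      unfolding time_bound.simps add_mult_distrib by linarith
  qed
next
  case (Cond p c c')
  then obtain K K' where K: "\<forall>m\<ge>1. time_bound m c \<le> K * m ^ loop_depth c"
    "\<forall>m\<ge>1. time_bound m c' \<le> K' * m ^ loop_depth c'" by blast
  show ?case
  proof (intro exI[of _ "bcost p + 1 + K + K'"] allI impI)
    fix m :: nat assume m: "1 \<le> m"
    let ?d = "loop_depth (Cond p c c')"
    have "K * m ^ loop_depth c \<le> K * m ^ ?d" "K' * m ^ loop_depth c' \<le> K' * m ^ ?d"
      using m by (simp_all add: power_increasing)
    moreover have "bcost p + 1 \<le> (bcost p + 1) * m ^ ?d"
      using mult_le_mono2[OF one_le_power[OF m]] by (simp only: mult_1_right)
    moreover have "time_bound m c \<le> K * m ^ loop_depth c" "time_bound m c' \<le> K' * m ^ loop_depth c'"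
      using K m by auto
    ultimately show "time_bound m (Cond p c c') \<le> (bcost p + 1 + K + K') * m ^ ?d"
      unfolding time_bound.simps add_mult_distrib by linarith
  qed
next
  case (Loop p c)
  then obtain K where K: "\<forall>m\<ge>1. time_bound m c \<le> K * m ^ loop_depth c" by blast
  show ?case
  \<comment> \<open>One \<open>bcost p + 1\<close> pays for the successful tests, the other for the
    final failing one.\<close>
  proof (intro exI[of _ "2 * (bcost p + 1) + K"] allI impI)
    fix m :: nat assume m: "1 \<le> m"
    let ?d = "loop_depth c" and ?b = "bcost p + 1"
    have 1: "?b \<le> ?b * m ^ ?d"
      using mult_le_mono2[OF one_le_power[OF m]] by (simp only: mult_1_right)
    have "m * (?b + time_bound m c) \<le> m * (?b * m ^ ?d + K * m ^ ?d)"
      using K m 1 by (intro mult_le_mono add_mono) auto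
    also have "\<dots> = ?b * m ^ Suc ?d + K * m ^ Suc ?d" by (simp add: algebra_simps)
    finally have "m * (?b + time_bound m c) \<le> ?b * m ^ Suc ?d + K * m ^ Suc ?d" .
    moreover have "?b \<le> ?b * m ^ Suc ?d"
      using mult_le_mono2[OF one_le_power[OF m]] by (simp only: mult_1_right)
    moreover have "(2 * ?b + K) * m ^ Suc ?d = ?b * m ^ Suc ?d + ?b * m ^ Suc ?d + K * m ^ Suc ?d"
      by (simp add: algebra_simps)
    ultimately show "time_bound m (Loop p c) \<le> (2 * ?b + K) * m ^ loop_depth (Loop p c)"
      unfolding time_bound.simps loop_depth.simps by linarith
  qed
qed auto

text \<open>Depth 1 is used with \<open>m = n * n\<close> or \<open>m = n\<close>, depth 2 only with
  \<open>m = n\<close>, so everything is quadratic. The outer loops of sorting and searching run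
  logarithmically often and are left to \<open>runs_Loop\<close>.\<close>

lemma loop_depths:
  "loop_depth rows_com = 1" "loop_depth copy_com = 1" "loop_depth merge_pass_com = 1" "loop_depth probe_com = 2"
  by (simp_all add: rows_com_def copy_com_def merge_pass_com_def merge_step_com_def next_block_com_def
      probe_com_def check_com_def reset_com_def cover_com_def reps_com_def weights_com_def heaviest_com_def
      centers_com_def extra_com_def label_com_def accept_com_def output_com_def For_def)

context indexed_instance
begin

lemma feasible_cong:
  assumes "\<And>i. i < n \<Longrightarrow> l i = l' i"
  shows "feasible C l = feasible C l'" "cost_le r l = cost_le r l'"
proof -
  have "{i. i < n \<and> lH i \<noteq> l i} = {i. i < n \<and> lH i \<noteq> l' i}" using assms by auto
  then show "feasible C l = feasible C l'" using assms by (simp add: feasible_def)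
  show "cost_le r l = cost_le r l'" using assms by (simp add: cost_le_def)
qed

definition solved :: "real \<Rightarrow> store \<Rightarrow> bool" where
  "solved r s \<longleftrightarrow> feasible {x. x < n \<and> narr s ''C'' x \<noteq> 0} (narr s ''lC'') \<and> cost_le r (narr s ''lC'')"

lemma probe_correct:
  assumes s: "inputs s" and lohi: "nvar s ''lo'' = lo" "nvar s ''hi'' = hi"
    and r: "r = rarr s ''A'' ((lo + hi) div 2)" "0 \<le> r"
  shows "bounded_run n probe_com s (\<lambda>s'.
    nvar s' ''lo'' = lo \<and> nvar s' ''hi'' = (lo + hi) div 2 \<and> solved (3 * r) s' \<or>
    nvar s' ''lo'' = (lo + hi) div 2 + 1 \<and> nvar s' ''hi'' = hi \<and>
      narr s' ''C'' = narr s ''C'' \<and> narr s' ''lC'' = narr s ''lC'' \<and>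
      \<not> (\<exists>C l. feasible C l \<and> cost_le r l))" (is "bounded_run n _ s ?Q")
proof -
  let ?mid = "(lo + hi) div 2"
  let ?set = "NAssign ''mid'' (NHalf (NPlus (NVar ''lo'') (NVar ''hi''))) ;; RAssign ''r'' (RArr ''A'' (NVar ''mid''))"
  let ?upd = "Cond (NLess (NConst 0) (NVar ''ok'')) (NAssign ''hi'' (NVar ''mid'') ;; output_com)
       (NAssign ''lo'' (NPlus (NVar ''mid'') (NConst 1)))"
  define s0 where "s0 = result ?set s"
  have s0: "inputs s0" "rvar s0 ''r'' = r" using s lohi r by (simp_all add: s0_def inputs_def)
  have "bounded_run n check_com s0 (\<lambda>s'. bounded_run n ?upd s' ?Q)"
  proof (rule bounded_run_mono[OF check_correct[OF s0 r(2)]])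
    fix s1 assume ag: "agree check_com s0 s1"
      and c: "(nvar s1 ''ok'' \<noteq> 0 \<longrightarrow> feasible {x. x < n \<and> narr s1 ''C0'' x \<noteq> 0} (narr s1 ''l0'') \<and>
         cost_le (3 * r) (narr s1 ''l0'')) \<and>
       (nvar s1 ''ok'' = 0 \<longrightarrow> \<not> (\<exists>C l. feasible C l \<and> cost_le r l))"
    have s1: "nvar s1 ''lo'' = lo" "nvar s1 ''hi'' = hi" "nvar s1 ''mid'' = ?mid" "nvar s1 ''n'' = n"
      "narr s1 ''C'' = narr s ''C''" "narr s1 ''lC'' = narr s ''lC''"
      using lohi s by (simp_all add: agreeD[OF ag] s0_def inputs_def)
    show "bounded_run n ?upd s1 ?Q"
    proof (rule bounded_run_Cond)
      assume "bval (NLess (NConst 0) (NVar ''ok'')) s1"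
      then have f: "feasible {x. x < n \<and> narr s1 ''C0'' x \<noteq> 0} (narr s1 ''l0'')"
        "cost_le (3 * r) (narr s1 ''l0'')" using c by auto
      let ?s1 = "set_nvar ''hi'' ?mid s1"
      have "bounded_run n output_com ?s1 ?Q"
      proof (rule bounded_run_mono[OF output_correct])
        fix s2 assume ag: "agree output_com ?s1 s2"
          and o: "\<forall>i<n. narr s2 ''C'' i = narr ?s1 ''C0'' i \<and> narr s2 ''lC'' i = narr ?s1 ''l0'' i"
        have "{x. x < n \<and> narr s2 ''C'' x \<noteq> 0} = {x. x < n \<and> narr s1 ''C0'' x \<noteq> 0}" using o by auto
        moreover have "narr s2 ''lC'' i = narr s1 ''l0'' i" if "i < n" for i using o that by simp
        ultimately have "solved (3 * r) s2"
          using f feasible_cong[of "narr s2 ''lC''" "narr s1 ''l0''"] by (simp add: solved_def)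
        moreover have "nvar s2 ''lo'' = lo" "nvar s2 ''hi'' = ?mid"
          using s1 by (simp_all add: agreeD[OF ag])
        ultimately show "?Q s2" by blast
      qed (use s1 in simp)
      then show "bounded_run n (NAssign ''hi'' (NVar ''mid'') ;; output_com) s1 ?Q"
        using s1 by (intro bounded_run_Seq[of _ "NAssign _ _"] bounded_run_loop_free[of "NAssign _ _"]) simp_all
    next
      assume "\<not> bval (NLess (NConst 0) (NVar ''ok'')) s1"
      then have "\<not> (\<exists>C l. feasible C l \<and> cost_le r l)" using c by simp
      then have "?Q (result (NAssign ''lo'' (NPlus (NVar ''mid'') (NConst 1))) s1)"
        using s1 by (intro disjI2) simp
      then show "bounded_run n (NAssign ''lo'' (NPlus (NVar ''mid'') (NConst 1))) s1 ?Q"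
        by (intro bounded_run_loop_free) simp_all
    qed
  qed
  from bounded_run_Seq[OF this] show ?thesis unfolding probe_com_def s0_def
    by (rule bounded_run_Seq[OF bounded_run_loop_free, rotated]) simp
qed

text \<open>
  An accepted guess need not be at least the optimal radius, so the search keeps the solution found
  at \<open>hi\<close> and does not assume that acceptance is monotone in the radius.
\<close>

lemma search_correct:
  assumes s: "inputs s" "nvar s ''N'' = N" "rarr s ''A'' = A" and A: "sorted_between A 0 N" "\<And>i. i < N \<Longrightarrow> 0 \<le> A i"
    and opt: "feasible C l" "cost_le r l" "r \<in> A ` {..<N}" and m: "N < 2 ^ m"
  shows "runs search_com s (m * (time_bound n probe_com + 4) + 8) (solved (3 * r))"
proof -
  let ?p = "NLess (NVar ''lo'') (NVar ''hi'')"
  let ?s = "set_nvar ''hi'' N (set_nvar ''lo'' 0 s)"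
  \<comment> \<open>\<open>hi = N\<close> means that nothing has been accepted yet; afterwards the
    saved output belongs to the guess \<open>A hi\<close>. The bound by \<open>2 ^ q\<close> is
    strict, so \<open>q = 0\<close> forces an empty interval.\<close>
  define I where "I q s' \<longleftrightarrow> nvar s' ''lo'' \<le> nvar s' ''hi'' \<and> nvar s' ''hi'' \<le> N \<and>
    nvar s' ''hi'' - nvar s' ''lo'' < 2 ^ q \<and> (\<forall>i < nvar s' ''lo''. A i < r) \<and>
    (nvar s' ''hi'' < N \<longrightarrow> solved (3 * A (nvar s' ''hi'')) s')" for q and s' :: store
  have "runs (Loop ?p probe_com) ?s (m * (bcost ?p + 1 + time_bound n probe_com) + (bcost ?p + 1))
      (\<lambda>s'. (\<exists>q. I q s') \<and> \<not> bval ?p s')"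
  proof (rule runs_Loop)
    show "I m ?s" using m by (simp add: I_def)
    fix q s' assume I: "I q s'" and p: "bval ?p s'" and ag: "agree probe_com ?s s'"
    let ?lo = "nvar s' ''lo''" and ?hi = "nvar s' ''hi''"
    let ?mid = "(?lo + ?hi) div 2"
    have in': "inputs s'" by (rule inputs_agree[OF _ ag]) (use s in \<open>simp_all add: inputs_def\<close>)
    have A': "rarr s' ''A'' = A" using s by (simp add: agreeD[OF ag])
    obtain q' where q': "q = Suc q'" using I p by (cases q) (auto simp: I_def)
    have mid: "?lo \<le> ?mid" "?mid < ?hi" "?mid < N" "?mid - ?lo < 2 ^ q'" "?hi - (?mid + 1) < 2 ^ q'"
      using I p q' by (auto simp: I_def)
    have "bounded_run n probe_com s' (I q')"
    proof (rule bounded_run_mono[OF probe_correct[OF in' refl refl refl]])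
      show "0 \<le> rarr s' ''A'' ?mid" using A(2) A' mid by simp
      fix s'' assume "nvar s'' ''lo'' = ?lo \<and> nvar s'' ''hi'' = ?mid \<and> solved (3 * rarr s' ''A'' ?mid) s'' \<or>
        nvar s'' ''lo'' = ?mid + 1 \<and> nvar s'' ''hi'' = ?hi \<and>
        narr s'' ''C'' = narr s' ''C'' \<and> narr s'' ''lC'' = narr s' ''lC'' \<and>
        \<not> (\<exists>C l. feasible C l \<and> cost_le (rarr s' ''A'' ?mid) l)"
      then show "I q' s''"
      proof (elim disjE conjE)
        assume "nvar s'' ''lo'' = ?lo" "nvar s'' ''hi'' = ?mid" "solved (3 * rarr s' ''A'' ?mid) s''"
        then show ?thesis using I mid A' by (simp add: I_def)
      next
        assume h: "nvar s'' ''lo'' = ?mid + 1" "nvar s'' ''hi'' = ?hi"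
          "narr s'' ''C'' = narr s' ''C''" "narr s'' ''lC'' = narr s' ''lC''"
          "\<not> (\<exists>C l. feasible C l \<and> cost_le (rarr s' ''A'' ?mid) l)"
        \<comment> \<open>A guess of at least \<open>r\<close> would admit \<open>l\<close> itself;
          so a rejected guess lies below \<open>r\<close>, and by sortedness so do all entries
          before it.\<close>
        have "A ?mid < r"
        proof (rule ccontr)
          assume "\<not> A ?mid < r"
          then have "cost_le (A ?mid) l" using opt(2) by (force simp: cost_le_def)
          then show False using h(5) opt(1) A' by auto
        qed
        moreover have "A i \<le> A ?mid" if "i < ?mid + 1" for i
          using A(1) that mid by (auto simp: sorted_between_def)
        ultimately have "\<forall>i<?mid + 1. A i < r" by (meson le_less_trans)
        moreover have "solved x s'' = solved x s'" for x using h by (simp add: solved_def)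
        ultimately show ?thesis using I mid h unfolding I_def by simp
      qed
    qed
    then show "\<exists>q'. q = Suc q' \<and> runs probe_com s' (time_bound n probe_com) (I q')"
      using q' by (auto simp: bounded_run_def)
  qed
  then have "runs (Loop ?p probe_com) ?s (m * (time_bound n probe_com + 4) + 4) (solved (3 * r))"
  proof (rule runs_mono)
    fix s' assume "(\<exists>q. I q s') \<and> \<not> bval ?p s'"
    then obtain q where I: "I q s'" and eq: "nvar s' ''lo'' = nvar s' ''hi''" by (auto simp: I_def)
    let ?h = "nvar s' ''hi''"
    obtain i where i: "i < N" "r = A i" using opt(3) by auto
    \<comment> \<open>An entry equal to \<open>r\<close> cannot lie before \<open>lo = hi\<close>.
      Hence \<open>hi < N\<close>, so some guess was accepted, and the last accepted one is at most
      \<open>r\<close>.\<close>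
    have "?h \<le> i" using I eq i by (force simp: I_def not_less[symmetric])
    then have "A ?h \<le> r" "?h < N" using A(1) i by (auto simp: sorted_between_def)
    then have "solved (3 * A ?h) s'" using I by (simp add: I_def)
    then show "solved (3 * r) s'" using \<open>A ?h \<le> r\<close> by (force simp: solved_def cost_le_def)
  qed (simp add: algebra_simps)
  moreover have "runs (NAssign ''lo'' (NConst 0) ;; NAssign ''hi'' (NVar ''N'')) s 4 (\<lambda>s'. s' = ?s)"
    using loop_free_runs[of "NAssign ''lo'' (NConst 0) ;; NAssign ''hi'' (NVar ''N'')" s N] s
    by (simp add: numeral_eq_Suc)
  ultimately have "runs (NAssign ''lo'' (NConst 0) ;; NAssign ''hi'' (NVar ''N'')) s 4
      (\<lambda>s'. runs (Loop ?p probe_com) s' (m * (time_bound n probe_com + 4) + 4) (solved (3 * r)))"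
    by (auto intro: runs_mono)
  from runs_Seq[OF this] show ?thesis unfolding search_com_def by (simp add: add.commute)
qed

text \<open>The optimum enters as a matrix entry \<open>D i0 j0\<close>, for the search can only hit
  values of the sorted list.\<close>

lemma cluster_correct:
  assumes s: "nvar s ''n'' = n" "nvar s ''k'' = k" "nvar s ''b'' = b"
      "\<And>i. i < n \<Longrightarrow> 0 < narr s ''H'' i \<longleftrightarrow> i \<in> H" "\<And>i. i < n \<Longrightarrow> narr s ''lH'' i = lH i"
      "\<And>i j. i < n \<Longrightarrow> j < n \<Longrightarrow> rarr s ''d'' (i * n + j) = D i j"
    and opt: "feasible C l" "cost_le (D i0 j0) l" "i0 < n" "j0 < n" and m: "n * n < 2 ^ m"
  shows "runs cluster_com s (time_bound n rows_com + (time_bound (n * n) copy_com +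
    ((m * (time_bound (n * n) merge_pass_com + 8) + 6) + (m * (time_bound n probe_com + 4) + 8))))
    (solved (3 * D i0 j0))"
  unfolding cluster_com_def
proof (rule runs_Seq, rule runs_mono[OF rows_correct[OF s(1), unfolded bounded_run_def] order_refl])
  fix s1 assume ag: "agree rows_com s s1" and r: "nvar s1 ''N'' = n * n \<and> (\<forall>i<n. narr s1 ''row'' i = i * n)"
  have in1: "inputs s1" and d1: "rarr s1 ''d'' = rarr s ''d''"
    using s r by (simp_all add: inputs_def agreeD[OF ag] rows_com_def)
  show "runs (copy_com ;; sort_com ;; search_com) s1 (time_bound (n * n) copy_com +
    ((m * (time_bound (n * n) merge_pass_com + 8) + 6) + (m * (time_bound n probe_com + 4) + 8)))
    (solved (3 * D i0 j0))"
  proof (rule runs_Seq, rule runs_mono[OF copy_correct[OF conjunct1[OF r], unfolded bounded_run_def] order_refl])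
    fix s2 assume ag: "agree copy_com s1 s2" and c: "\<forall>i<n * n. rarr s2 ''A'' i = rarr s1 ''d'' i"
    have in2: "inputs s2" by (rule inputs_agree[OF in1 ag]) (simp_all add: copy_com_def)
    have N2: "nvar s2 ''N'' = n * n" using r by (simp add: agreeD[OF ag] copy_com_def)
    show "runs (sort_com ;; search_com) s2
      ((m * (time_bound (n * n) merge_pass_com + 8) + 6) + (m * (time_bound n probe_com + 4) + 8))
      (solved (3 * D i0 j0))"
    proof (rule runs_Seq, rule runs_mono[OF sort_correct[OF N2 less_imp_le[OF m]] order_refl])
      fix s3 assume ag: "agree sort_com s2 s3" and A: "sorted_between (rarr s3 ''A'') 0 (n * n) \<and>
        rarr s3 ''A'' ` {..<n * n} = rarr s2 ''A'' ` {..<n * n}"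
      have in3: "inputs s3" by (rule inputs_agree[OF in2 ag]) simp_all
      have N3: "nvar s3 ''N'' = n * n" using N2 by (simp add: agreeD[OF ag])
      have val: "rarr s2 ''A'' x = D (x div n) (x mod n)" if "x < n * n" for x
      proof -
        have "0 < n" using that by (cases n) auto
        then have "x div n < n" "x mod n < n" using that by (simp_all add: less_mult_imp_div_less)
        from s(6)[OF this] show ?thesis using c that d1 by simp
      qed
      have "D i0 j0 \<in> rarr s2 ''A'' ` {..<n * n}"
      proof (rule image_eqI)
        have "i0 * n + j0 < Suc i0 * n" using opt by simp
        also have "\<dots> \<le> n * n" using opt by (intro mult_le_mono1) simp
        finally show "i0 * n + j0 \<in> {..<n * n}" by simp
        then show "D i0 j0 = rarr s2 ''A'' (i0 * n + j0)" using val opt by simp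
      qed
      then have "D i0 j0 \<in> rarr s3 ''A'' ` {..<n * n}" using A by simp
      moreover have "0 \<le> rarr s3 ''A'' x" if "x < n * n" for x
      proof -
        have "rarr s3 ''A'' x \<in> rarr s2 ''A'' ` {..<n * n}" using A that by blast
        then show ?thesis using val D_nonneg by auto
      qed
      ultimately show "runs search_com s3 (m * (time_bound n probe_com + 4) + 8) (solved (3 * D i0 j0))"
        using search_correct[OF in3 N3 refl _ _ opt(1,2) _ m] A by blast
    qed
  qed
qed

end

section \<open>Between points and indices\<close>

lemma index_of_pt:
  assumes "bij_betw pt {..<card X} X"
  shows "x \<in> X \<Longrightarrow> index_of X pt x < card X" "x \<in> X \<Longrightarrow> pt (index_of X pt x) = x"
    "i < card X \<Longrightarrow> index_of X pt (pt i) = i" "i < card X \<Longrightarrow> pt i \<in> X"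
proof -
  note bij = assms[unfolded bij_betw_def]
  show "index_of X pt x < card X" if "x \<in> X"
    using the_inv_into_into[of pt "{..<card X}" x "{..<card X}"] bij that by (auto simp: index_of_def)
  show "pt (index_of X pt x) = x" if "x \<in> X"
    using f_the_inv_into_f[of pt "{..<card X}" x] bij that by (auto simp: index_of_def)
  show "index_of X pt (pt i) = i" if "i < card X"
    using the_inv_into_f_f[of pt "{..<card X}" i] bij that by (auto simp: index_of_def)
  show "pt i \<in> X" if "i < card X" using bij that by auto
qed

text \<open>Solutions are transported both ways along the enumeration: an optimal one to indices, to
  instantiate \<open>cluster_correct\<close>, and the computed one back to points.\<close>

lemma cluster_solves_instance:
  fixes X :: "'a set"
  assumes inst: "lc_instance X d k b \<H>" and bij: "bij_betw pt {..<card X} X"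
    and m: "card X * card X < 2 ^ m"
  shows "runs cluster_com (lc_input X d pt k b \<H>)
    (time_bound (card X) rows_com + (time_bound (card X * card X) copy_com +
      ((m * (time_bound (card X * card X) merge_pass_com + 8) + 6) +
       (m * (time_bound (card X) probe_com + 4) + 8))))
    (\<lambda>s. lc_feasible X k b \<H> (lc_output X pt s) \<and>
      cost_inf X d (lc_output X pt s) \<le> 3 * lc_opt X d k b \<H>)"
proof -
  define n where "n = card X"
  let ?ix = "index_of X pt"
  define D where "D i j = d (pt i) (pt j)" for i j
  define H where "H = {i. i < n \<and> pt i \<in> fst \<H>}"
  define lH where "lH i = ?ix (snd \<H> (pt i))" for i
  have X: "finite X" and metric: "Metric_space X d" and k: "0 < k" and cl: "is_clustering X k \<H>"
    using inst by (auto simp: lc_instance_def)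
  interpret M: Metric_space X d by (rule metric)
  have HX: "fst \<H> \<subseteq> X" "card (fst \<H>) = k" and lab: "\<And>x. x \<in> X \<Longrightarrow> snd \<H> x \<in> fst \<H>"
    using cl by (auto simp: is_clustering_def)
  note ix = index_of_pt[OF bij, folded n_def]
  have inj_pt: "inj_on pt A" if "A \<subseteq> {..<n}" for A
    using bij that by (auto simp: bij_betw_def n_def intro: inj_on_subset)
  have inj_ix: "inj_on ?ix A" if "A \<subseteq> X" for A
    using that ix(2) by (intro inj_on_inverseI[of _ pt]) auto
  have "pt ` H = fst \<H>" using ix HX by (force simp: H_def)
  moreover have "H \<subseteq> {..<n}" by (auto simp: H_def)
  ultimately have card_H: "card H = k" using card_image[OF inj_pt] HX by metis
  interpret indexed_instance n k b D H lH
  proof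
    show "H \<subseteq> {..<n}" by (auto simp: H_def)
    show "card H = k" by (rule card_H)
    show "lH i \<in> H" if "i < n" for i
    proof -
      have "snd \<H> (pt i) \<in> fst \<H>" using lab ix(4) that by blast
      then show ?thesis using ix(1,2) HX by (auto simp: H_def lH_def)
    qed
    show "D i l \<le> D i j + D j l" if "i < n" "j < n" "l < n" for i j l
      using that ix(4) by (simp add: D_def M.triangle)
  qed (use ix(4) M.commute in \<open>auto simp: D_def\<close>)
  obtain \<O> where O: "lc_feasible X k b \<H> \<O>" "cost_inf X d \<O> = lc_opt X d k b \<H>"
    using lc_opt_attained(1)[OF inst] by blast
  then have OX: "fst \<O> \<subseteq> X" "card (fst \<O>) = k" "\<And>x. x \<in> X \<Longrightarrow> snd \<O> x \<in> fst \<O>"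
    and Ob: "label_diff X \<H> \<O> \<le> b" by (auto simp: lc_feasible_def is_clustering_def)
  define lO where "lO i = ?ix (snd \<O> (pt i))" for i
  have ne: "X \<noteq> {}" using HX k by auto
  have "feasible (?ix ` fst \<O>) lO"
  proof -
    have "card {i. i < n \<and> lH i \<noteq> lO i} \<le> card {x \<in> X. snd \<H> x \<noteq> snd \<O> x}"
      using X ix(4) by (intro card_inj_on_le[of pt] inj_pt) (auto simp: lH_def lO_def)
    then have "card {i. i < n \<and> lH i \<noteq> lO i} \<le> b" using Ob by (simp add: label_diff_def)
    then show ?thesis using OX ix card_image[OF inj_ix[OF OX(1)]]
      by (auto simp: feasible_def lO_def)
  qed
  moreover have "cost_inf X d \<O> \<in> (\<lambda>x. d x (snd \<O> x)) ` X"
    unfolding cost_inf_def using X ne by (intro Max_in) auto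
  then obtain x0 where x0: "x0 \<in> X" "cost_inf X d \<O> = d x0 (snd \<O> x0)" by blast
  have y0: "snd \<O> x0 \<in> X" using OX x0 by blast
  have opt: "lc_opt X d k b \<H> = D (?ix x0) (?ix (snd \<O> x0))"
    using x0 y0 O(2) ix(2) by (simp add: D_def)
  moreover have "cost_le (D (?ix x0) (?ix (snd \<O> x0))) lO"
  proof -
    have "D i (lO i) \<le> cost_inf X d \<O>" if "i < n" for i
    proof -
      have "pt i \<in> X" "snd \<O> (pt i) \<in> X" using ix(4) OX that by blast+
      then show ?thesis using X ix(2) unfolding D_def lO_def cost_inf_def by (auto intro!: Max_ge)
    qed
    then show ?thesis using O(2) opt by (simp add: cost_le_def)
  qed
  ultimately have run: "runs cluster_com (lc_input X d pt k b \<H>)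
    (time_bound n rows_com + (time_bound (n * n) copy_com +
      ((m * (time_bound (n * n) merge_pass_com + 8) + 6) + (m * (time_bound n probe_com + 4) + 8))))
    (solved (3 * lc_opt X d k b \<H>))"
    unfolding opt
  proof (intro cluster_correct)
    fix i j assume ij: "i < n" "j < n"
    have "i * n + j < Suc i * n" using ij by simp
    also have "\<dots> \<le> n * n" using ij by (intro mult_le_mono1) simp
    finally show "rarr (lc_input X d pt k b \<H>) ''d'' (i * n + j) = D i j"
      using ij by (simp add: lc_input_def n_def[symmetric] D_def)
  qed (use ix(1) x0 y0 m in \<open>auto simp: lc_input_def n_def[symmetric] H_def lH_def Let_def\<close>)
  have "lc_feasible X k b \<H> (lc_output X pt s) \<and> cost_inf X d (lc_output X pt s) \<le> 3 * lc_opt X d k b \<H>"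
    if "solved (3 * lc_opt X d k b \<H>) s" for s
  proof -
    let ?C = "{x. x < n \<and> narr s ''C'' x \<noteq> 0}" and ?l = "narr s ''lC''"
    have f: "card ?C = k" "\<And>i. i < n \<Longrightarrow> ?l i \<in> ?C" "card {i. i < n \<and> lH i \<noteq> ?l i} \<le> b"
      and c: "\<And>i. i < n \<Longrightarrow> D i (?l i) \<le> 3 * lc_opt X d k b \<H>"
      using that by (auto simp: solved_def feasible_def cost_le_def)
    have out: "lc_output X pt s = (pt ` ?C, \<lambda>x. pt (?l (?ix x)))"
      by (simp add: lc_output_def n_def)
    have "?C \<subseteq> {..<n}" by auto
    then have "card (pt ` ?C) = k" using f(1) card_image[OF inj_pt] by metis
    moreover have "pt ` ?C \<subseteq> X" using ix(4) by auto
    moreover have "card {x \<in> X. snd \<H> x \<noteq> pt (?l (?ix x))} \<le> card {i. i < n \<and> lH i \<noteq> ?l i}"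
    proof (rule card_inj_on_le[of ?ix])
      show "inj_on ?ix {x \<in> X. snd \<H> x \<noteq> pt (?l (?ix x))}" by (rule inj_ix) auto
      have "lH (?ix x) \<noteq> ?l (?ix x)" if x: "x \<in> X" "snd \<H> x \<noteq> pt (?l (?ix x))" for x
      proof
        assume "lH (?ix x) = ?l (?ix x)"
        moreover have "snd \<H> x \<in> X" using lab x HX by blast
        ultimately have "snd \<H> x = pt (?l (?ix x))" using x ix(2) by (metis lH_def)
        then show False using x by blast
      qed
      then show "?ix ` {x \<in> X. snd \<H> x \<noteq> pt (?l (?ix x))} \<subseteq> {i. i < n \<and> lH i \<noteq> ?l i}"
        using ix(1) by auto
    qed simp
    moreover have "(\<lambda>x. pt (?l (?ix x))) \<in> X \<rightarrow> pt ` ?C" by (intro Pi_I imageI f(2) ix(1))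
    ultimately have "lc_feasible X k b \<H> (lc_output X pt s)"
      using f(3) by (simp add: out lc_feasible_def is_clustering_def label_diff_def)
    moreover have "d x (pt (?l (?ix x))) \<le> 3 * lc_opt X d k b \<H>" if "x \<in> X" for x
      using c[OF ix(1)[OF that]] ix(2)[OF that] by (simp add: D_def)
    then have "cost_inf X d (lc_output X pt s) \<le> 3 * lc_opt X d k b \<H>"
      unfolding out cost_inf_def using X ne by (subst Max_le_iff) simp_all
    ultimately show ?thesis by blast
  qed
  then show ?thesis using runs_mono[OF run order_refl] by (simp add: n_def)
qed

text \<open>From \<open>n < 2 ^ L\<close> with \<open>L\<close> one more than the floor of the
  logarithm, squaring gives the exponent \<open>2 * L\<close>. This one \<open>m\<close> bounds both
  the merge passes and the probes.\<close>

lemma log_exponent: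
  fixes n :: nat
  assumes "1 \<le> n"
  obtains m :: nat where "n * n < 2 ^ m" "real m \<le> 2 * log 2 n + 2"
proof
  define L where "L = nat \<lfloor>log 2 n\<rfloor> + 1"
  have log: "0 \<le> log 2 n" using assms by simp
  have "log 2 n < L" using log unfolding L_def by linarith
  then have "real n < 2 powr L" using assms by (simp add: log_less_iff)
  then have "real n < real (2 ^ L)" by (simp add: powr_realpow)
  then have "n < 2 ^ L" by (simp only: of_nat_less_iff)
  then have "n * n < 2 ^ L * 2 ^ L" by (intro mult_strict_mono) auto
  then show "n * n < 2 ^ (2 * L)" by (simp add: power_add mult_2)
  show "real (2 * L) \<le> 2 * log 2 n + 2" using of_nat_floor[OF log] by (simp add: L_def)
qed

theorem theorem3:
  shows "\<exists>(P :: com) (c :: real) (n\<^sub>0 :: nat).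
    \<forall>(X :: 'a set) (d :: 'a \<Rightarrow> 'a \<Rightarrow> real) (pt :: nat \<Rightarrow> 'a) (k :: nat) (b :: nat) (\<H> :: 'a clustering).
      lc_instance X d k b \<H> \<and> bij_betw pt {..<card X} X \<longrightarrow>
      (\<exists>(t :: nat) (s :: store).
         exec P (lc_input X d pt k b \<H>) t s \<and>
         lc_feasible X k b \<H> (lc_output X pt s) \<and>
         cost_inf X d (lc_output X pt s) \<le> 3 * lc_opt X d k b \<H> \<and>
         (n\<^sub>0 \<le> card X \<longrightarrow>
            real t \<le> c * ((real (card X))\<^sup>2 * log 2 (real (card X))
                          + real (card X) * real k * log 2 (real (card X)))))"
proof -
  \<comment> \<open>These constants depend on the program texts only, so they can be fixed before
    the instance.\<close>
  obtain K1 K2 K3 K4 where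
    K: "\<And>m. 1 \<le> m \<Longrightarrow> time_bound m rows_com \<le> K1 * m" "\<And>m. 1 \<le> m \<Longrightarrow> time_bound m copy_com \<le> K2 * m"
      "\<And>m. 1 \<le> m \<Longrightarrow> time_bound m merge_pass_com \<le> K3 * m"
      "\<And>m. 1 \<le> m \<Longrightarrow> time_bound m probe_com \<le> K4 * m ^ 2"
    using time_bound_polynomial[of rows_com] time_bound_polynomial[of copy_com]
      time_bound_polynomial[of merge_pass_com] time_bound_polynomial[of probe_com]
    unfolding loop_depths power_one_right by blast
  \<comment> \<open>26 collects the constants \<open>8 + 4\<close> per iteration of the two outer
    loops and \<open>6 + 8\<close> outside them.\<close>
  define K where "K = K1 + K2 + K3 + K4 + 26"
  have time: "time_bound n rows_com + (time_bound (n * n) copy_com +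
      ((m * (time_bound (n * n) merge_pass_com + 8) + 6) + (m * (time_bound n probe_com + 4) + 8)))
      \<le> K * (n * n) * (m + 1)" if n: "1 \<le> n" for n m
  proof -
    define q where "q = n * n"
    have q: "1 \<le> q" "n \<le> q" using n by (auto simp: q_def)
    have "time_bound n rows_com \<le> K1 * q" using K(1)[OF n] q by (meson le_trans mult_le_mono2)
    moreover have "time_bound q copy_com \<le> K2 * q" using K(2)[OF q(1)] .
    moreover have "m * (time_bound q merge_pass_com + 8) \<le> m * ((K3 + 8) * q)"
      using K(3)[OF q(1)] q by (intro mult_le_mono2) (simp add: add_mult_distrib)
    moreover have "m * (time_bound n probe_com + 4) \<le> m * ((K4 + 4) * q)"
      using K(4)[OF n] q by (intro mult_le_mono2) (simp add: add_mult_distrib power2_eq_square flip: q_def)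
    moreover have "K * q * (m + 1) = K1 * q + K2 * q + m * ((K3 + 8) * q) + m * ((K4 + 4) * q) + 14 * q
        + (K3 * q + K4 * q + 12 * q + m * ((K1 + K2 + 14) * q))"
      by (simp add: K_def algebra_simps)
    ultimately show ?thesis using q unfolding q_def[symmetric] by linarith
  qed
  show ?thesis
  \<comment> \<open>For a single point the logarithm vanishes and the bound with it, hence the
    threshold 2.\<close>
  proof (rule exI[of _ cluster_com], rule exI[of _ "5 * real K"], rule exI[of _ 2], intro allI impI)
    fix X :: "'a set" and d :: "'a \<Rightarrow> 'a \<Rightarrow> real" and pt k b and \<H> :: "'a clustering"
    assume *: "lc_instance X d k b \<H> \<and> bij_betw pt {..<card X} X"
    define n where "n = card X"
    have "finite X" "X \<noteq> {}" using * by (auto simp: lc_instance_def is_clustering_def)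
    then have n: "1 \<le> n" by (simp add: n_def Suc_le_eq card_gt_0_iff)
    obtain m where m: "n * n < 2 ^ m" "real m \<le> 2 * log 2 n + 2" using log_exponent[OF n] by blast
    obtain t s where ts: "exec cluster_com (lc_input X d pt k b \<H>) t s"
      "lc_feasible X k b \<H> (lc_output X pt s)" "cost_inf X d (lc_output X pt s) \<le> 3 * lc_opt X d k b \<H>"
      and t: "t \<le> K * (n * n) * (m + 1)"
      using cluster_solves_instance[of X d k b \<H> pt m] * m(1) le_trans[OF _ time[OF n, of m]]
      unfolding runs_def n_def by blast
    have "real t \<le> 5 * real K * ((real n)\<^sup>2 * log 2 n + real n * real k * log 2 n)" if "2 \<le> n"
    proof -
      have log: "1 \<le> log 2 n" using that by (simp add: le_log_iff)
      have "real t \<le> real (K * (n * n) * (m + 1))" using t by (rule of_nat_mono)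
      also have "\<dots> = real K * (real n)\<^sup>2 * (real m + 1)" by (simp add: power2_eq_square algebra_simps)
      \<comment> \<open>\<open>m + 1 \<le> 2 * log 2 n + 3 \<le> 5 * log 2 n\<close>, as the
        logarithm is at least 1.\<close>
      also have "\<dots> \<le> real K * (real n)\<^sup>2 * (5 * log 2 n)"
        using m(2) log by (intro mult_left_mono) auto
      also have "\<dots> = 5 * real K * ((real n)\<^sup>2 * log 2 n)" by simp
      also have "\<dots> \<le> 5 * real K * ((real n)\<^sup>2 * log 2 n + real n * real k * log 2 n)"
        using log by (intro mult_left_mono) auto
      finally show ?thesis .
    qed
    then show "\<exists>(t :: nat) (s :: store).
         exec cluster_com (lc_input X d pt k b \<H>) t s \<and>
         lc_feasible X k b \<H> (lc_output X pt s) \<and>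
         cost_inf X d (lc_output X pt s) \<le> 3 * lc_opt X d k b \<H> \<and>
         (2 \<le> card X \<longrightarrow>
            real t \<le> 5 * real K * ((real (card X))\<^sup>2 * log 2 (real (card X))
                          + real (card X) * real k * log 2 (real (card X))))"
      using ts unfolding n_def by blast
  qed
qed

end
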